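(* For every $k=1,2,\dots,n$, $\ \mathbf H_k(n)=\mathbf S_{(1^k)}(n)\in\boldsymbol\zeta(n)$, where $(1^k)$ is the column shape of depth $k$.
   Context: $\boldsymbol\zeta(n)$ is the center of $\mathbf U(gl(n))$ (over $\mathbb C$). Virtual symbols. Let $\mathcal L=\{1,\dots,n\}$, and let $\mathcal A_0=\{\alpha_1,\dots,\alpha_{m_0}\}$, $\mathcal A_1=\{\beta_1,\dots,\beta_{m_1}\}$ be finite sets of auxiliary (virtual) symbols, with $m_0,m_1$ sufficiently large. Put $|a|=0\in\mathbb Z_2$ for $a\in\mathcal A_0$ and $|a|=1\in\mathbb Z_2$ for $a\in\mathcal A_1\cup\mathcal L$. Let $gl(m_0|m_1+n)$ be the complex Lie superalgebra with basis $e_{a,b}$, $a,b\in\mathcal A_0\cup\mathcal A_1\cup\mathcal L$, $|e_{a,b}|=|a|+|b|$, and superbracket $[e_{a,b},e_{c,d}]=\delta_{bc}e_{a,d}-(-1)^{(|a|+|b|)(|c|+|d|)}\delta_{ad}e_{c,b}$. Its enveloping superalgebra $\mathbf U(gl(m_0|m_1+n))$ contains $\mathbf U(gl(n))$ as the subalgebra generated by $e_{i,j}$, $i,j\in\mathcal L$. Devirtualization. A product $e_{a_m,b_m}\cdots e_{a_1,b_1}$ is irregular if there are $i\le m$ and a virtual symbol $\gamma\in\mathcal A_0\cup\mathcal A_1$ with $\#\{j\le i: b_j=\gamma\}>\#\{j<i: a_j=\gamma\}$. Let $\mathbf{Irr}$ be the left ideal of $\mathbf U(gl(m_0|m_1+n))$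 generated by the irregular products. The sum $Virt=\mathbf U(gl(n))+\mathbf{Irr}$ is direct and is a subalgebra, in which $\mathbf{Irr}$ is a two-sided ideal; $\mathfrak p:Virt\to\mathbf U(gl(n))$ denotes the projection with kernel $\mathbf{Irr}$ (an algebra epimorphism). Tableaux. A Young tableau of shape $\lambda$ over an alphabet is any filling of the cells of the Ferrers diagram of $\lambda$ (rows of lengths $\lambda_1\ge\lambda_2\ge\cdots$). For tableaux $S,T$ of the same shape, $e_{S,T}$ is the product of the $e_{S(c),T(c)}$ over the cells $c$, read row by row from top to bottom, left to right in each row. $D^*_\lambda$ is the tableau of shape $\lambda$ whose $r$-th row is $\beta_1\beta_2\cdots\beta_{\lambda_r}$, and $C^*_\lambda$ the tableau of shape $\lambda$ whose $r$-th row is $\alpha_r\alpha_r\cdots\alpha_r$ (the $\alpha$'s and $\beta$'s being arbitrary distinct positive, resp. negative, virtual symbols). For tableaux $S,T$ of shape $\lambda$ over $\mathcal L$, the double Young-Capelli bitableau is $[\,\boxed{S\,|\,T}\,]=\mathfrak p\big(e_{S,C^*_\lambda}e_{C^*_\lambda,D^*_\lambda}e_{D^*_\lambda,C^*_\lambda}e_{C^*_\lambda,T}\big)\in\mathbf U(gl(n))$; the argument of $\mathfrak p$ lies in $Virt$ and the result does not depend on the choice of virtual symbols. Schur elements. $\widetilde\lambda$ is the conjugate partition and $H(\lambda)=H(\widetilde\lambda)$ the product of the hook lengths of all boxes of the Ferrers diagram. For $\widetilde\lambda_1\le n$, $\mathbf S_\lambda(n)=\frac1{H(\widetilde\lambda)}\sum_S[\,\boxed{S\,|\,S}\,]$,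 the sum over all tableaux $S$ of shape $\widetilde\lambda$ on $\mathcal L$ with strictly increasing rows (no condition on columns). Capelli elements. For $\alpha\in\mathcal A_0$ and $k=1,\dots,n$, $\mathbf H_k(n)=\sum_{1\le i_1<\cdots<i_k\le n}\mathfrak p\big(e_{i_k,\alpha}\cdots e_{i_2,\alpha}e_{i_1,\alpha}\,e_{\alpha,i_1}e_{\alpha,i_2}\cdots e_{\alpha,i_k}\big)\in\mathbf U(gl(n))$. *)

theory Defs
  imports Complex_Main "HOL-Library.Poly_Mapping"
begin

section \<open>Free associative algebras over the complex numbers\<close>

text \<open>
  The free algebra on a type of generators is the monoid algebra of the free monoid.  Words are
  wrapped in a type of their own because the convolution product of \<^theory>\<open>HOL-Library.Poly_Mapping\<close>
  needs the monoid of exponents to be written additively.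
\<close>

datatype 'g word = Word (letters: "'g list")

instantiation word :: (type) monoid_add
begin

definition zero_word :: "'a word" where "0 = Word []"

definition plus_word :: "'a word \<Rightarrow> 'a word \<Rightarrow> 'a word" where
  "u + v = Word (letters u @ letters v)"

instance
  by standard (simp_all add: zero_word_def plus_word_def)

end

type_synonym 'g free_alg = "'g word \<Rightarrow>\<^sub>0 complex"

definition const :: "complex \<Rightarrow> 'g free_alg" where
  "const c = Poly_Mapping.single 0 c"

definition gen :: "'g \<Rightarrow> 'g free_alg" where
  "gen g = Poly_Mapping.single (Word [g]) 1"

section \<open>The enveloping superalgebra of \<open>gl(m\<^sub>0|m\<^sub>1+n)\<close>\<close>

text \<open>
  The three alphabets are types: \<open>'a\<close> is the alphabet \<open>\<A>\<^sub>0\<close> of positive virtual symbols, \<open>'b\<close> the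
  alphabet \<open>\<A>\<^sub>1\<close> of negative virtual symbols and \<open>'l\<close> the linearly ordered alphabet
  \<open>\<L> = {1,\<dots>,n}\<close> of proper symbols, so that \<open>m\<^sub>0\<close>, \<open>m\<^sub>1\<close>, \<open>n\<close> are their cardinalities.
\<close>

datatype ('a, 'b, 'l) sym = Pos 'a | Neg 'b | Proper 'l

fun par :: "('a, 'b, 'l) sym \<Rightarrow> nat" where
  "par (Pos _) = 0"
| "par (Neg _) = 1"
| "par (Proper _) = 1"

fun virtual :: "('a, 'b, 'l) sym \<Rightarrow> bool" where
  "virtual (Proper _) = False"
| "virtual _ = True"

type_synonym ('a, 'b, 'l) epair = "('a, 'b, 'l) sym \<times> ('a, 'b, 'l) sym"

text \<open>
  Parities are natural numbers read modulo 2; they only enter through the signs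
  \<open>(-1)\<^bsup>|e\<^sub>a\<^sub>b||e\<^sub>c\<^sub>d|\<^esup>\<close>.
\<close>

fun gl_sign :: "('a, 'b, 'l) epair \<Rightarrow> ('a, 'b, 'l) epair \<Rightarrow> complex" where
  "gl_sign (a, b) (c, d) = (-1) ^ ((par a + par b) * (par c + par d))"

fun gl_bracket ::
    "('a, 'b, 'l) epair \<Rightarrow> ('a, 'b, 'l) epair \<Rightarrow> ('a, 'b, 'l) epair free_alg" where
  "gl_bracket (a, b) (c, d) =
     (if b = c then gen (a, d) else 0) -
     const (gl_sign (a, b) (c, d)) * (if a = d then gen (c, b) else 0)"

definition gl_relator ::
    "('a, 'b, 'l) epair \<Rightarrow> ('a, 'b, 'l) epair \<Rightarrow> ('a, 'b, 'l) epair free_alg" where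
  "gl_relator p q =
     gen p * gen q - const (gl_sign p q) * (gen q * gen p) - gl_bracket p q"

inductive_set gl_ideal :: "('a, 'b, 'l) epair free_alg set" where
  zero: "0 \<in> gl_ideal"
| step: "u \<in> gl_ideal \<Longrightarrow> u + x * gl_relator p q * y \<in> gl_ideal"

lemma gl_ideal_relator: "x * gl_relator p q * y \<in> gl_ideal"
  using gl_ideal.step[OF gl_ideal.zero] by simp

lemma gl_ideal_add:
  assumes "u \<in> gl_ideal" and "v \<in> gl_ideal"
  shows "u + v \<in> gl_ideal"
  using assms(2,1)
proof (induction v rule: gl_ideal.induct)
  case (step v x p q y)
  then show ?case
    using gl_ideal.step[of "u + v" x p q y] by (simp add: add.assoc)
qed simp

lemma gl_ideal_mult: "u \<in> gl_ideal \<Longrightarrow> r * u * s \<in> gl_ideal"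
proof (induction u rule: gl_ideal.induct)
  case zero
  show ?case by (simp add: gl_ideal.zero)
next
  case (step u x p q y)
  then show ?case
    using gl_ideal.step[of "r * u * s" "r * x" p q "y * s"] by (simp add: algebra_simps)
qed

lemma gl_ideal_mult_left: "u \<in> gl_ideal \<Longrightarrow> r * u \<in> gl_ideal"
  using gl_ideal_mult[of u r 1] by simp

lemma gl_ideal_mult_right: "u \<in> gl_ideal \<Longrightarrow> u * s \<in> gl_ideal"
  using gl_ideal_mult[of u 1 s] by simp

lemma gl_ideal_uminus: "u \<in> gl_ideal \<Longrightarrow> - u \<in> gl_ideal"
  using gl_ideal_mult_left[of u "- 1"] by simp

lemma gl_ideal_diff: "u \<in> gl_ideal \<Longrightarrow> v \<in> gl_ideal \<Longrightarrow> u - v \<in> gl_ideal"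
  using gl_ideal_add[OF _ gl_ideal_uminus, of u v] by simp

lemma lookup_mult_0:
  fixes x y :: "'g free_alg"
  shows "Poly_Mapping.lookup (x * y) 0 = Poly_Mapping.lookup x 0 * Poly_Mapping.lookup y 0"
proof -
  have split: "0 = l + q \<longleftrightarrow> l = 0 \<and> q = 0" for l q :: "'g word"
    by (cases l; cases q) (auto simp: zero_word_def plus_word_def)
  have "Poly_Mapping.lookup (x * y) 0 =
      Sum_any (\<lambda>l. Poly_Mapping.lookup x l *
        Sum_any (\<lambda>q. Poly_Mapping.lookup y q when l = 0 \<and> q = 0))"
    by (simp add: lookup_mult split)
  also have "\<dots> = Sum_any (\<lambda>l. Poly_Mapping.lookup x l * Poly_Mapping.lookup y 0 when l = 0)"
    by (rule Sum_any.cong) (simp add: when_def)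
  finally show ?thesis by simp
qed

lemma one_notin_gl_ideal: "1 \<notin> gl_ideal"
proof -
  have gen0: "Poly_Mapping.lookup (gen g) 0 = 0" for g :: "('a, 'b, 'l) epair"
    by (simp add: gen_def zero_word_def lookup_single)
  have "Poly_Mapping.lookup (gl_bracket p q) 0 = 0" for p q :: "('a, 'b, 'l) epair"
    by (cases p; cases q) (simp add: lookup_minus lookup_mult_0 gen0)
  then have rel0: "Poly_Mapping.lookup (gl_relator p q) 0 = 0" for p q :: "('a, 'b, 'l) epair"
    by (simp add: gl_relator_def lookup_minus lookup_mult_0 gen0)
  have "Poly_Mapping.lookup u 0 = 0" if "u \<in> gl_ideal" for u :: "('a, 'b, 'l) epair free_alg"
    using that by induction (simp_all add: lookup_add lookup_mult_0 rel0)
  from this[of 1] show ?thesis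
    by (auto simp: lookup_one)
qed

quotient_type ('a, 'b, 'l) Ugl =
  "('a, 'b, 'l) epair free_alg" / "\<lambda>x y. x - y \<in> gl_ideal"
proof (rule equivpI)
  show "reflp (\<lambda>x y :: ('a, 'b, 'l) epair free_alg. x - y \<in> gl_ideal)"
    by (simp add: reflp_def gl_ideal.zero)
  show "symp (\<lambda>x y :: ('a, 'b, 'l) epair free_alg. x - y \<in> gl_ideal)"
    using gl_ideal_uminus by (fastforce intro: sympI)
  show "transp (\<lambda>x y :: ('a, 'b, 'l) epair free_alg. x - y \<in> gl_ideal)"
    using gl_ideal_add by (fastforce intro: transpI)
qed

instantiation Ugl :: (type, type, type) ring_1
begin

lift_definition zero_Ugl :: "('a, 'b, 'l) Ugl" is 0 .

lift_definition one_Ugl :: "('a, 'b, 'l) Ugl" is 1 .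

lift_definition plus_Ugl :: "('a, 'b, 'l) Ugl \<Rightarrow> ('a, 'b, 'l) Ugl \<Rightarrow> ('a, 'b, 'l) Ugl" is "(+)"
  by (metis add_diff_add gl_ideal_add)

lift_definition uminus_Ugl :: "('a, 'b, 'l) Ugl \<Rightarrow> ('a, 'b, 'l) Ugl" is uminus
  by (metis gl_ideal_uminus minus_diff_minus)

lift_definition minus_Ugl :: "('a, 'b, 'l) Ugl \<Rightarrow> ('a, 'b, 'l) Ugl \<Rightarrow> ('a, 'b, 'l) Ugl" is "(-)"
proof -
  fix x x' y y' :: "('a, 'b, 'l) epair free_alg"
  assume "x - x' \<in> gl_ideal" "y - y' \<in> gl_ideal"
  then have "(x - x') - (y - y') \<in> gl_ideal"
    by (rule gl_ideal_diff)
  then show "x - y - (x' - y') \<in> gl_ideal"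
    by (simp add: algebra_simps)
qed

lift_definition times_Ugl :: "('a, 'b, 'l) Ugl \<Rightarrow> ('a, 'b, 'l) Ugl \<Rightarrow> ('a, 'b, 'l) Ugl" is "(*)"
proof -
  fix x x' y y' :: "('a, 'b, 'l) epair free_alg"
  assume "x - x' \<in> gl_ideal" "y - y' \<in> gl_ideal"
  then have "(x - x') * y + x' * (y - y') \<in> gl_ideal"
    by (intro gl_ideal_add gl_ideal_mult_left gl_ideal_mult_right)
  then show "x * y - x' * y' \<in> gl_ideal"
    by (simp add: algebra_simps)
qed

instance
proof
  fix a b c :: "('a, 'b, 'l) Ugl"
  show "a + b + c = a + (b + c)" by transfer (simp add: algebra_simps gl_ideal.zero)
  show "a + b = b + a" by transfer (simp add: algebra_simps gl_ideal.zero)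
  show "0 + a = a" by transfer (simp add: gl_ideal.zero)
  show "- a + a = 0" by transfer (simp add: gl_ideal.zero)
  show "a - b = a + - b" by transfer (simp add: gl_ideal.zero)
  show "a * b * c = a * (b * c)" by transfer (simp add: mult.assoc gl_ideal.zero)
  show "(a + b) * c = a * c + b * c" by transfer (simp add: algebra_simps gl_ideal.zero)
  show "a * (b + c) = a * b + a * c" by transfer (simp add: algebra_simps gl_ideal.zero)
  show "1 * a = a" by transfer (simp add: gl_ideal.zero)
  show "a * 1 = a" by transfer (simp add: gl_ideal.zero)
  show "(0 :: ('a, 'b, 'l) Ugl) \<noteq> 1"
    by transfer (metis diff_0 gl_ideal_uminus minus_minus one_notin_gl_ideal)
qed

end

lift_definition scaleU :: "complex \<Rightarrow> ('a, 'b, 'l) Ugl \<Rightarrow> ('a, 'b, 'l) Ugl" is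
  "\<lambda>c x. const c * x"
  by (metis gl_ideal_mult_left right_diff_distrib)

lift_definition e_gl :: "('a, 'b, 'l) sym \<Rightarrow> ('a, 'b, 'l) sym \<Rightarrow> ('a, 'b, 'l) Ugl" is
  "\<lambda>a b. gen (a, b)" .

lemma e_commutation:
  "e_gl a b * e_gl c d - scaleU ((-1) ^ ((par a + par b) * (par c + par d))) (e_gl c d * e_gl a b) =
     (if b = c then e_gl a d else 0) -
     scaleU ((-1) ^ ((par a + par b) * (par c + par d))) (if a = d then e_gl c b else 0)"
proof (transfer, goal_cases)
  case (1 a b c d)
  show ?case
    using gl_ideal_relator[of 1 "(a, b)" "(c, d)" 1]
    by (simp only: gl_relator_def gl_bracket.simps gl_sign.simps mult_1_left mult_1_right)
qed

section \<open>\<open>U(gl(n))\<close>, its center, and the devirtualization map\<close>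

inductive_set Ugl_proper :: "('a, 'b, 'l) Ugl set" where
  scalar: "scaleU c 1 \<in> Ugl_proper"
| generator: "e_gl (Proper i) (Proper j) \<in> Ugl_proper"
| add: "x \<in> Ugl_proper \<Longrightarrow> y \<in> Ugl_proper \<Longrightarrow> x + y \<in> Ugl_proper"
| mult: "x \<in> Ugl_proper \<Longrightarrow> y \<in> Ugl_proper \<Longrightarrow> x * y \<in> Ugl_proper"

definition center_Ugl_proper :: "('a, 'b, 'l) Ugl set" where
  "center_Ugl_proper = {z \<in> Ugl_proper. \<forall>x \<in> Ugl_proper. z * x = x * z}"

definition e_word :: "('a, 'b, 'l) epair list \<Rightarrow> ('a, 'b, 'l) Ugl" where
  "e_word w = prod_list (map (\<lambda>(a, b). e_gl a b) w)"

text \<open>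
  The list \<open>w\<close> is read from left to right as \<open>[(a\<^sub>m, b\<^sub>m), \<dots>, (a\<^sub>1, b\<^sub>1)]\<close>; indices into the reversed
  list start at 0.
\<close>

definition irregular :: "('a, 'b, 'l) epair list \<Rightarrow> bool" where
  "irregular w \<longleftrightarrow>
     (\<exists>i < length w. \<exists>\<gamma>. virtual \<gamma> \<and>
        card {j. j \<le> i \<and> snd (rev w ! j) = \<gamma>} > card {j. j < i \<and> fst (rev w ! j) = \<gamma>})"

inductive_set Irr :: "('a, 'b, 'l) Ugl set" where
  zero: "0 \<in> Irr"
| step: "u \<in> Irr \<Longrightarrow> irregular w \<Longrightarrow> u + x * e_word w \<in> Irr"

text \<open>
  The projection of \<open>Virt = U(gl(n)) \<oplus> Irr\<close> onto the first summand; the value at an element outside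
  \<open>Virt\<close> is meaningless.
\<close>

definition devirt :: "('a, 'b, 'l) Ugl \<Rightarrow> ('a, 'b, 'l) Ugl" where
  "devirt x = (THE u. u \<in> Ugl_proper \<and> x - u \<in> Irr)"

section \<open>Tableaux and double Young-Capelli bitableaux\<close>

text \<open>
  A partition is the weakly decreasing list of its (positive) parts, and a tableau is the list of
  its rows.
\<close>

definition first_part :: "nat list \<Rightarrow> nat" where
  "first_part \<mu> = (case \<mu> of [] \<Rightarrow> 0 | r # _ \<Rightarrow> r)"

definition conjugate :: "nat list \<Rightarrow> nat list" where
  "conjugate \<mu> = map (\<lambda>j. length (filter (\<lambda>r. j < r) \<mu>)) [0..<first_part \<mu>]"

definition cells :: "nat list \<Rightarrow> (nat \<times> nat) set" where
  "cells \<mu> = {(i, j). i < length \<mu> \<and> j < \<mu> ! i}"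

definition hook :: "nat list \<Rightarrow> nat \<times> nat \<Rightarrow> (nat \<times> nat) set" where
  "hook \<mu> = (\<lambda>(i, j). {(i', j') \<in> cells \<mu>. i' = i \<and> j \<le> j' \<or> j' = j \<and> i \<le> i'})"

definition hook_product :: "nat list \<Rightarrow> nat" where
  "hook_product \<mu> = (\<Prod>c \<in> cells \<mu>. card (hook \<mu> c))"

definition tableaux :: "nat list \<Rightarrow> 's list list set" where
  "tableaux \<mu> = {T. map length T = \<mu>}"

definition e_tab ::
    "('a, 'b, 'l) sym list list \<Rightarrow> ('a, 'b, 'l) sym list list \<Rightarrow> ('a, 'b, 'l) Ugl" where
  "e_tab S T = e_word (zip (concat S) (concat T))"

definition D_star :: "(nat \<Rightarrow> 'b) \<Rightarrow> nat list \<Rightarrow> ('a, 'b, 'l) sym list list" where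
  "D_star \<beta> \<mu> = map (\<lambda>r. map (\<lambda>s. Neg (\<beta> s)) [1..<Suc r]) \<mu>"

definition C_star :: "(nat \<Rightarrow> 'a) \<Rightarrow> nat list \<Rightarrow> ('a, 'b, 'l) sym list list" where
  "C_star \<alpha> \<mu> = map (\<lambda>r. replicate (\<mu> ! (r - 1)) (Pos (\<alpha> r))) [1..<Suc (length \<mu>)]"

text \<open>
  The virtual symbols occurring in the starred tableaux of shape \<open>\<mu>\<close> are pairwise distinct.  Such
  \<open>\<alpha>\<close> and \<open>\<beta>\<close> exist iff the virtual alphabets are large enough for the shape.
\<close>

definition admissible :: "(nat \<Rightarrow> 'a) \<Rightarrow> (nat \<Rightarrow> 'b) \<Rightarrow> nat list \<Rightarrow> bool" where
  "admissible \<alpha> \<beta> \<mu> \<longleftrightarrow> inj_on \<alpha> {1..length \<mu>} \<and> inj_on \<beta> {1..first_part \<mu>}"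

definition double_young_capelli ::
    "(nat \<Rightarrow> 'a) \<Rightarrow> (nat \<Rightarrow> 'b) \<Rightarrow> nat list \<Rightarrow> 'l list list \<Rightarrow> 'l list list \<Rightarrow> ('a, 'b, 'l) Ugl" where
  "double_young_capelli \<alpha> \<beta> \<mu> S T =
     devirt (e_tab (map (map Proper) S) (C_star \<alpha> \<mu>) * e_tab (C_star \<alpha> \<mu>) (D_star \<beta> \<mu>) *
       e_tab (D_star \<beta> \<mu>) (C_star \<alpha> \<mu>) * e_tab (C_star \<alpha> \<mu>) (map (map Proper) T))"

section \<open>Schur elements and Capelli elements\<close>

definition row_strict_tableaux :: "nat list \<Rightarrow> 'l::linorder list list set" where
  "row_strict_tableaux \<mu> = {S \<in> tableaux \<mu>. \<forall>row \<in> set S. sorted_wrt (<) row}"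

definition schur_element ::
    "(nat \<Rightarrow> 'a) \<Rightarrow> (nat \<Rightarrow> 'b) \<Rightarrow> nat list \<Rightarrow> ('a, 'b, 'l::{finite, linorder}) Ugl" where
  "schur_element \<alpha> \<beta> \<mu> =
     scaleU (1 / of_nat (hook_product (conjugate \<mu>)))
       (\<Sum>S \<in> row_strict_tableaux (conjugate \<mu>). double_young_capelli \<alpha> \<beta> (conjugate \<mu>) S S)"

definition capelli_element :: "'a \<Rightarrow> nat \<Rightarrow> ('a, 'b, 'l::{finite, linorder}) Ugl" where
  "capelli_element \<alpha> k =
     (\<Sum>is \<in> {is. length is = k \<and> sorted_wrt (<) is}.
        devirt (prod_list (map (\<lambda>i. e_gl (Proper i) (Pos \<alpha>)) (rev is)) *
                prod_list (map (\<lambda>i. e_gl (Pos \<alpha>) (Proper i)) is)))"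

end

theory Submission
  imports Defs "HOL-Combinatorics.Multiset_Permutations"
begin

text \<open>
  The virtual superalgebra acts by superderivations on functions on words over the symbols and a
  trivial copy of \<open>\<L>\<close>.  A function without virtual content is killed by every irregular product,
  whereas \<open>U(gl(n))\<close> acts faithfully on such functions: a product of \<open>d\<close> generators is recovered, up
  to products of fewer generators, from its matrix coefficients in tensor degree \<open>d\<close>; the trivial
  copy serves to discard the tensor factors left untouched.  Hence \<open>U(gl(n))\<close> meets \<open>Irr\<close> trivially
  and devirtualization is well defined.

  Modulo \<open>Irr\<close>, the operators \<open>e\<^bsub>\<alpha>\<beta>\<^esub>\<close> undo the \<open>e\<^bsub>\<beta>\<alpha>\<^esub>\<close> one at a time, each step multiplying
  by the number of \<open>\<alpha>\<close> then present.  For one row of length \<open>k\<close> this yields the factor \<open>k!\<close>, which is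
  the hook product, times the Capelli summand; the two signs from reversing the order of odd
  factors cancel.  For centrality, the sum of the virtual Capelli products over all index lists is
  an iterate of \<open>z \<mapsto> \<Sum>\<^sub>i e\<^bsub>i\<alpha>\<^esub> z e\<^bsub>\<alpha>i\<^esub>\<close> applied to \<open>1\<close>, and this map preserves commutation with \<open>gl(n)\<close>.
\<close>

section \<open>Linear structure\<close>

lemma free_alg_induct [case_names zero add]:
  fixes u :: "'g free_alg"
  assumes "P 0" and "\<And>u k c. P u \<Longrightarrow> P (Poly_Mapping.single k c + u)"
  shows "P u"
proof (induction u rule: update_induct)
  case const
  show ?case
    using assms(1) by simp
next
  case (update f a b)
  have "Poly_Mapping.update a b f = Poly_Mapping.single a b + f"
    using update.hyps
    by (intro poly_mapping_eqI) (auto simp: lookup_update lookup_add lookup_single in_keys_iff when_def)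
  then show ?case
    using assms(2)[OF update.IH] by simp
qed

lemma const_commute: "const c * x = x * const c"
  by (induction x rule: free_alg_induct)
    (simp_all add: const_def mult_single algebra_simps)

lemma const_add: "const (c + d) = const c + const d"
  by (simp add: const_def single_add)

lemma const_mult: "const (c * d) = const c * const d"
  by (simp add: const_def mult_single)

lemma const_1: "const 1 = 1"
  by (simp add: const_def)

lemma scaleU_add_right: "scaleU c (x + y) = scaleU c x + scaleU c y"
  by transfer (simp add: distrib_left gl_ideal.zero)

lemma scaleU_add_left: "scaleU (c + d) x = scaleU c x + scaleU d x"
  by transfer (simp add: const_add distrib_right gl_ideal.zero)

lemma scaleU_scaleU: "scaleU c (scaleU d x) = scaleU (c * d) x"
  by transfer (simp add: const_mult mult.assoc gl_ideal.zero)

lemma scaleU_1 [simp]: "scaleU 1 x = x"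
  by transfer (simp add: const_1 gl_ideal.zero)

lemma mult_scaleU_left [simp]: "scaleU c x * y = scaleU c (x * y)"
  by transfer (simp add: mult.assoc gl_ideal.zero)

lemma mult_scaleU_right [simp]: "x * scaleU c y = scaleU c (x * y)"
proof (transfer, goal_cases)
  case (1 x c y)
  have "x * (const c * y) = const c * (x * y)"
    by (metis const_commute mult.assoc)
  then show ?case
    by (simp add: gl_ideal.zero)
qed

interpretation Ugl: vector_space scaleU
  by standard (simp_all add: scaleU_add_right scaleU_add_left scaleU_scaleU)

lemma scaleU_of_nat: "scaleU (of_nat m) x = of_nat m * x"
  by (induction m) (simp_all add: scaleU_add_left algebra_simps)

lemma e_commute:
  "e_gl a b * e_gl c d = scaleU ((-1) ^ ((par a + par b) * (par c + par d)))
      (e_gl c d * e_gl a b - (if a = d then e_gl c b else 0)) + (if b = c then e_gl a d else 0)"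
  using e_commutation[of a b c d] by (simp add: Ugl.scale_right_diff_distrib algebra_simps)

definition lin :: "('g word \<Rightarrow> complex) \<Rightarrow> 'g free_alg \<Rightarrow> complex" where
  "lin \<omega> u = (\<Sum>k\<in>Poly_Mapping.keys u. Poly_Mapping.lookup u k * \<omega> k)"

lemma lin_add: "lin \<omega> (u + v) = lin \<omega> u + lin \<omega> v"
  unfolding lin_def by (rule setsum_keys_plus_distrib) (simp_all add: distrib_right)

lemma lin_single [simp]: "lin \<omega> (Poly_Mapping.single k c) = c * \<omega> k"
  by (cases "c = 0") (simp_all add: lin_def)

lemma lin_0 [simp]: "lin \<omega> 0 = 0"
  by (simp add: lin_def)

section \<open>The action on tensors\<close>

text \<open>
  The letters \<open>Inr i\<close> span a trivial representation.
\<close>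

type_synonym ('a, 'b, 'l) tensor = "(('a, 'b, 'l) sym + 'l) list \<Rightarrow> complex"

fun tpar :: "('a, 'b, 'l) sym + 'l \<Rightarrow> nat" where
  "tpar (Inl a) = par a"
| "tpar (Inr _) = 0"

text \<open>A function is the coefficient family of a tensor: reading off \<open>f\<close> at words
  with one \<open>a\<close> turned into \<open>b\<close> amounts to replacing \<open>b\<close> by
  \<open>a\<close> in basis tensors. The sign is the Koszul sign for passing the letters further
  left.\<close>

fun eact :: "('a, 'b, 'l) epair \<Rightarrow> ('a, 'b, 'l) tensor \<Rightarrow> ('a, 'b, 'l) tensor" where
  "eact (a, b) f [] = 0"
| "eact (a, b) f (x # w) = (if x = Inl a then f (Inl b # w) else 0) +
     (-1) ^ ((par a + par b) * tpar x) * eact (a, b) (\<lambda>v. f (x # v)) w"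

lemma eact_lincomb:
  "eact p (\<lambda>w. c * f w + g w) w = c * eact p f w + eact p g w"
  by (induction p f w arbitrary: g rule: eact.induct) (simp_all add: algebra_simps)

lemma eact_zero: "eact p (\<lambda>_. 0) w = 0"
  using eact_lincomb[of p 1 "\<lambda>_. 0" "\<lambda>_. 0" w] by simp

lemma eact_add: "eact p (\<lambda>w. f w + g w) w = eact p f w + eact p g w"
  using eact_lincomb[of p 1 f g w] by simp

lemma eact_if: "eact p (\<lambda>w. if P then f w else 0) w = (if P then eact p f w else 0)"
  by (simp add: eact_zero)

lemma par_cases: "par a = 0 \<or> par a = 1"
  by (cases a) simp_all

lemma tpar_cases: "tpar x = 0 \<or> tpar x = 1"
  using par_cases by (cases x) auto

text \<open>Generators act as superderivations: on the first letter the relation is that of matrix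
  units, the mixed terms cancel by the Koszul signs, and the rest of the word is the induction
  hypothesis.\<close>

lemma eact_supercommutator:
  "eact (a, b) (eact (c, d) f) w - gl_sign (a, b) (c, d) * eact (c, d) (eact (a, b) f) w =
     (if b = c then eact (a, d) f w else 0) -
     gl_sign (a, b) (c, d) * (if a = d then eact (c, b) f w else 0)"
proof (induction w arbitrary: f)
  case (Cons x w)
  have step: "eact p (\<lambda>v. (if P then g v else 0) + c * h v) v =
      (if P then eact p g v else 0) + c * eact p h v" for p P c g h v
    using eact_lincomb[of p c h "\<lambda>v. if P then g v else 0" v] by (simp add: add.commute eact_if)
  \<comment> \<open>Only parities and coincidences of letters matter, which leaves finitely many
    cases.\<close>
  show ?case
    using Cons.IH[of "\<lambda>v. f (x # v)"] par_cases[of a] par_cases[of b] par_cases[of c] par_cases[of d]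
      tpar_cases[of x]
    by (simp only: eact.simps step gl_sign.simps)
      (elim disjE; cases "x = Inl a"; cases "x = Inl c"; cases "b = c"; cases "a = d"; simp add: algebra_simps)
qed simp

lemma foldr_eact_lincomb:
  "foldr eact ps (\<lambda>w. c * f w + g w) = (\<lambda>w. c * foldr eact ps f w + foldr eact ps g w)"
proof (induction ps)
  case (Cons p ps)
  then show ?case
    by (auto simp: eact_lincomb)
qed simp

definition act :: "('a, 'b, 'l) epair free_alg \<Rightarrow> ('a, 'b, 'l) tensor \<Rightarrow> ('a, 'b, 'l) tensor" where
  "act u f = (\<lambda>w. lin (\<lambda>k. foldr eact (letters k) f w) u)"

lemma act_0 [simp]: "act 0 f = (\<lambda>_. 0)"
  by (simp add: act_def)

lemma act_add: "act (u + v) f = (\<lambda>w. act u f w + act v f w)"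
  by (simp add: act_def lin_add)

lemma act_single: "act (Poly_Mapping.single k c) f = (\<lambda>w. c * foldr eact (letters k) f w)"
  by (simp add: act_def)

lemma act_uminus: "act (- u) f = (\<lambda>w. - act u f w)"
  using act_add[of u "- u" f] by (simp add: fun_eq_iff eq_neg_iff_add_eq_0 add.commute)

lemma act_diff: "act (u - v) f = (\<lambda>w. act u f w - act v f w)"
  using act_add[of u "- v" f] by (simp add: act_uminus)

lemma act_gen: "act (gen p) f = eact p f"
  by (simp add: gen_def act_single)

lemma act_const: "act (const c) f = (\<lambda>w. c * f w)"
  by (simp add: const_def act_single zero_word_def)

lemma act_lincomb: "act u (\<lambda>w. c * f w + g w) = (\<lambda>w. c * act u f w + act u g w)"
proof (induction u rule: free_alg_induct)
  case (add u k d)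
  then show ?case
    by (simp add: act_add act_single foldr_eact_lincomb) (simp add: algebra_simps)
qed simp

lemma act_zero_right [simp]: "act u (\<lambda>_. 0) = (\<lambda>_. 0)"
  using act_lincomb[of u 1 "\<lambda>_. 0" "\<lambda>_. 0"] by (simp add: fun_eq_iff)

lemma act_mult_single:
  "act (Poly_Mapping.single k c * v) f = act (Poly_Mapping.single k c) (act v f)"
proof (induction v rule: free_alg_induct)
  case (add u l d)
  then show ?case
    using foldr_eact_lincomb[of "letters k" d "foldr eact (letters l) f" "act u f"]
    by (simp add: distrib_left act_add mult_single act_single plus_word_def algebra_simps)
qed simp

lemma act_mult: "act (u * v) f = act u (act v f)"
  by (induction u rule: free_alg_induct) (simp_all add: distrib_right act_add act_mult_single)

lemma act_gl_relator: "act (gl_relator p q) f = (\<lambda>_. 0)"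
proof -
  obtain a b c d where pq: "p = (a, b)" "q = (c, d)"
    by (cases p; cases q)
  have "act (gl_relator p q) f w = 0" for w
    using eact_supercommutator[of a b c d f w]
    by (cases "b = c"; cases "a = d")
      (simp_all add: pq gl_relator_def act_add act_diff act_mult act_gen act_const)
  then show ?thesis by blast
qed

lemma act_gl_ideal: "u \<in> gl_ideal \<Longrightarrow> act u f = (\<lambda>_. 0)"
  by (induction rule: gl_ideal.induct) (simp_all add: act_add act_mult act_gl_relator)

lift_definition rho :: "('a, 'b, 'l) Ugl \<Rightarrow> ('a, 'b, 'l) tensor \<Rightarrow> ('a, 'b, 'l) tensor" is act
proof -
  fix u v :: "('a, 'b, 'l) epair free_alg"
  assume "u - v \<in> gl_ideal"
  then have "act (u - v) f = (\<lambda>_. 0)" for f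
    by (rule act_gl_ideal)
  then show "act u = act v"
    by (simp add: act_diff fun_eq_iff)
qed

lemma rho_0 [simp]: "rho 0 f = (\<lambda>_. 0)"
  by transfer simp

lemma rho_1 [simp]: "rho 1 f = f"
  by transfer (simp add: act_const flip: const_1)

lemma rho_add: "rho (x + y) f = (\<lambda>w. rho x f w + rho y f w)"
  by transfer (simp add: act_add)

lemma rho_mult: "rho (x * y) f = rho x (rho y f)"
  by transfer (simp add: act_mult)

lemma rho_scaleU: "rho (scaleU c x) f = (\<lambda>w. c * rho x f w)"
  by transfer (simp add: act_mult act_const)

lemma rho_e_gl: "rho (e_gl a b) f = eact (a, b) f"
  by transfer (simp add: act_gen)

lemma rho_zero_right [simp]: "rho x (\<lambda>_. 0) = (\<lambda>_. 0)"
  by transfer simp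

lemma rho_e_word: "rho (e_word w) f = foldr eact w f"
  by (induction w arbitrary: f) (auto simp: e_word_def rho_mult rho_e_gl)

section \<open>Content of tensors and irregular words\<close>

definition content :: "('a, 'b, 'l) sym \<Rightarrow> int \<Rightarrow> ('a, 'b, 'l) tensor \<Rightarrow> bool" where
  "content \<gamma> m f \<longleftrightarrow> (\<forall>w. f w \<noteq> 0 \<longrightarrow> int (count_list w (Inl \<gamma>)) = m)"

text \<open>The operator trades one \<open>b\<close> for one \<open>a\<close>. The second conjunct,
  that a \<open>b\<close> must be present to be traded, is what makes irregular products
  vanish.\<close>

lemma eact_nonzero_content:
  assumes "content \<gamma> m f" and "eact (a, b) f w \<noteq> 0"
  shows "int (count_list w (Inl \<gamma>)) = m - of_bool (b = \<gamma>) + of_bool (a = \<gamma>) \<and> of_bool (b = \<gamma>) \<le> m"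
  using assms
proof (induction w arbitrary: f m)
  case (Cons x w)
  show ?case
  proof (cases "x = Inl a \<and> f (Inl b # w) \<noteq> 0")
    case True
    then have "int (count_list (Inl b # w) (Inl \<gamma>)) = m"
      using Cons.prems(1) unfolding content_def by blast
    then show ?thesis
      using True by (auto split: if_splits)
  next
    case False
    then have "eact (a, b) (\<lambda>v. f (x # v)) w \<noteq> 0"
      using Cons.prems(2) by (auto split: if_splits)
    moreover have "content \<gamma> (m - of_bool (x = Inl \<gamma>)) (\<lambda>v. f (x # v))"
      unfolding content_def
    proof (intro allI impI)
      fix v
      assume "f (x # v) \<noteq> 0"
      then have "int (count_list (x # v) (Inl \<gamma>)) = m"
        using Cons.prems(1) unfolding content_def by blast
      then show "int (count_list v (Inl \<gamma>)) = m - of_bool (x = Inl \<gamma>)"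
        by (auto split: if_splits)
    qed
    ultimately show ?thesis
      using Cons.IH[of "m - of_bool (x = Inl \<gamma>)" "\<lambda>v. f (x # v)"]
      by (cases "x = Inl \<gamma>") (auto split: if_splits)
  qed
qed simp

text \<open>Contents are integers because this difference may be negative; only the zero function
  has negative content.\<close>

lemma content_foldr_eact:
  assumes "content \<gamma> 0 f"
  shows "content \<gamma> (int (count_list (map fst w) \<gamma>) - int (count_list (map snd w) \<gamma>)) (foldr eact w f)"
proof (induction w)
  case (Cons p w)
  then show ?case
    using eact_nonzero_content[OF Cons.IH, of "fst p" "snd p"]
    unfolding content_def by (cases p) auto
qed (use assms in simp)

lemma card_index_eq_count_list:
  assumes "i \<le> length xs"
  shows "card {j. j < i \<and> xs ! j = x} = count_list (take i xs) x"
proof -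
  have "count_list (take i xs) x = card {j. j < length (take i xs) \<and> x = take i xs ! j}"
    by (simp add: count_list_eq_length_filter length_filter_conv_card)
  also have "{j. j < length (take i xs) \<and> x = take i xs ! j} = {j. j < i \<and> xs ! j = x}"
    using assms by auto
  finally show ?thesis ..
qed

text \<open>Rightmost factors act first, so \<open>v\<close> has acted when \<open>p\<close> does:
  at \<open>p\<close> more copies of \<open>\<gamma>\<close> are used up than \<open>v\<close> has
  created. Splitting the word replaces index arithmetic on the reversed list.\<close>

lemma irregular_iff:
  "irregular w \<longleftrightarrow> (\<exists>u p v \<gamma>. w = u @ p # v \<and> virtual \<gamma> \<and>
     count_list (map snd (p # v)) \<gamma> > count_list (map fst v) \<gamma>)" (is "_ \<longleftrightarrow> ?R")
proof -
  \<comment> \<open>An initial segment of the reversed word is a suffix of \<open>w\<close>; the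
    bound \<open>j \<le> i\<close> gives a suffix one letter longer than
    \<open>j < i\<close>.\<close>
  have key: "card {j. j \<le> i \<and> snd (rev w ! j) = \<gamma>} = count_list (map snd (drop (length w - Suc i) w)) \<gamma>"
    "card {j. j < i \<and> fst (rev w ! j) = \<gamma>} = count_list (map fst (drop (length w - i) w)) \<gamma>"
    if "i < length w" for i \<gamma>
  proof -
    have "{j. j \<le> i \<and> snd (rev w ! j) = \<gamma>} = {j. j < Suc i \<and> map snd (rev w) ! j = \<gamma>}"
      "{j. j < i \<and> fst (rev w ! j) = \<gamma>} = {j. j < i \<and> map fst (rev w) ! j = \<gamma>}"
      using that by auto
    then show "card {j. j \<le> i \<and> snd (rev w ! j) = \<gamma>} = count_list (map snd (drop (length w - Suc i) w)) \<gamma>"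
      "card {j. j < i \<and> fst (rev w ! j) = \<gamma>} = count_list (map fst (drop (length w - i) w)) \<gamma>"
      using that card_index_eq_count_list[of "Suc i" "map snd (rev w)" \<gamma>]
        card_index_eq_count_list[of i "map fst (rev w)" \<gamma>]
      by (simp_all add: take_map take_rev drop_map flip: rev_map)
  qed
  show ?thesis
  proof
    assume "irregular w"
    then obtain i \<gamma> where i: "i < length w" "virtual \<gamma>"
      "count_list (map snd (drop (length w - Suc i) w)) \<gamma> > count_list (map fst (drop (length w - i) w)) \<gamma>"
      unfolding irregular_def using key by auto
    define n where "n = length w - Suc i"
    have n: "n < length w" "length w - i = Suc n"
      using i(1) by (auto simp: n_def)
    have "w = take n w @ w ! n # drop (Suc n) w"
      using n id_take_nth_drop by blast
    moreover have "drop n w = w ! n # drop (Suc n) w"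
      using n by (simp add: Cons_nth_drop_Suc)
    ultimately show ?R
      using i n by (metis n_def)
  next
    assume ?R
    then obtain u p v \<gamma> where w: "w = u @ p # v" "virtual \<gamma>"
      "count_list (map snd (p # v)) \<gamma> > count_list (map fst v) \<gamma>"
      by blast
    then show "irregular w"
      unfolding irregular_def using key[of "length v" \<gamma>] by (intro exI[of _ "length v"]) auto
  qed
qed

text \<open>When \<open>p\<close> acts, the content in \<open>\<gamma>\<close> is what
  \<open>v\<close> has created minus what \<open>v\<close> has used, and irregularity says that
  \<open>p\<close> needs more than that.\<close>

lemma irregular_foldr_eact:
  assumes "irregular w" and "\<And>\<gamma>. virtual \<gamma> \<Longrightarrow> content \<gamma> 0 f"
  shows "foldr eact w f = (\<lambda>_. 0)"
proof -
  obtain u p v \<gamma> where w: "w = u @ p # v" "virtual \<gamma>"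
      "count_list (map snd (p # v)) \<gamma> > count_list (map fst v) \<gamma>"
    using assms(1) irregular_iff by blast
  have "eact p (foldr eact v f) x = 0" for x
    using eact_nonzero_content[OF content_foldr_eact[OF assms(2)[OF w(2)]], of "fst p" "snd p" v x] w(3)
    by (auto split: if_splits)
  then have "foldr eact (p # v) f = (\<lambda>_. 0)"
    by auto
  moreover have "foldr eact u (\<lambda>_. 0) = (\<lambda>_. 0)" for u :: "('a, 'b, 'c) epair list"
    using rho_e_word[of u "\<lambda>_. 0"] by simp
  ultimately show ?thesis
    by (simp add: w)
qed

lemma rho_Irr:
  assumes "x \<in> Irr" and "\<And>\<gamma>. virtual \<gamma> \<Longrightarrow> content \<gamma> 0 f"
  shows "rho x f = (\<lambda>_. 0)"
  using assms(1)
  by induction (simp_all add: rho_add rho_mult rho_e_word irregular_foldr_eact[OF _ assms(2)])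

section \<open>Faithfulness on the proper part\<close>

definition pword :: "('l \<times> 'l) list \<Rightarrow> ('a, 'b, 'l) Ugl" where
  "pword K = e_word (map (map_prod Proper Proper) K)"

lemma pword_Nil [simp]: "pword [] = 1"
  by (simp add: pword_def e_word_def)

lemma pword_Cons: "pword (p # K) = e_gl (Proper (fst p)) (Proper (snd p)) * pword K"
  by (cases p) (simp add: pword_def e_word_def)

abbreviation pact :: "('l \<times> 'l) list \<Rightarrow> ('a, 'b, 'l) tensor \<Rightarrow> ('a, 'b, 'l) tensor" where
  "pact K \<equiv> foldr eact (map (map_prod Proper Proper) K)"

lemma rho_pword: "rho (pword K) f = pact K f"
  by (simp add: pword_def rho_e_word)

text \<open>The tensor product of the vectors \<open>Inl (Proper j) + Inr j\<close> over the
  list.\<close>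

fun test_vector :: "'l list \<Rightarrow> ('a, 'b, 'l) tensor" where
  "test_vector [] w = of_bool (w = [])"
| "test_vector (j # js) [] = 0"
| "test_vector (j # js) (x # w) = (if x = Inl (Proper j) \<or> x = Inr j then test_vector js w else 0)"

text \<open>The tensor product of the differences of the coordinate functionals at
  \<open>Inl (Proper i)\<close> and \<open>Inr i\<close>. On an untouched factor of a test vector
  such a difference is 1 - 1 or 0 - 0, so only terms in which every factor is acted upon
  survive.\<close>

fun test_functional :: "'l list \<Rightarrow> ('a, 'b, 'l) tensor \<Rightarrow> complex" where
  "test_functional [] f = f []"
| "test_functional (i # is) f =
     test_functional is (\<lambda>w. f (Inl (Proper i) # w)) - test_functional is (\<lambda>w. f (Inr i # w))"

lemma content_test_vector:
  fixes \<gamma> :: "('a, 'b, 'l) sym"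
  assumes "virtual \<gamma>"
  shows "content \<gamma> 0 (test_vector js)"
  unfolding content_def
proof (intro allI impI)
  fix w :: "(('a, 'b, 'l) sym + 'l) list"
  assume "test_vector js w \<noteq> 0"
  then show "int (count_list w (Inl \<gamma>)) = 0"
    using assms by (induction js w rule: test_vector.induct) (auto split: if_splits)
qed

lemma test_functional_lincomb:
  "test_functional is (\<lambda>w. c * f w + g w) = c * test_functional is f + test_functional is g"
  by (induction "is" arbitrary: f g) (simp_all add: algebra_simps)

lemma test_functional_0 [simp]: "test_functional is (\<lambda>_. 0) = 0"
  by (induction "is") simp_all

lemma test_functional_sum_list:
  "test_functional is (\<lambda>w. \<Sum>x\<leftarrow>xs. f x w) = (\<Sum>x\<leftarrow>xs. test_functional is (f x))"
proof (induction xs)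
  case (Cons x xs)
  then show ?case
    using test_functional_lincomb[of "is" 1 "f x"] by simp
qed simp

lemma eact_sum_list: "eact p (\<lambda>w. \<Sum>x\<leftarrow>xs. f x w) w = (\<Sum>x\<leftarrow>xs. eact p (f x) w)"
  by (induction xs) (simp_all add: eact_zero eact_add)

text \<open>
  Moving a word of proper generators past the first tensor factor distributes its letters over the
  first factor and the rest; the list collects the words acting on the rest when the letters
  acting on the first factor take \<open>j\<close> to \<open>m\<close>.
\<close>

fun residual_words :: "('l \<times> 'l) list \<Rightarrow> 'l \<Rightarrow> 'l \<Rightarrow> ('l \<times> 'l) list list" where
  "residual_words [] m j = (if m = j then [[]] else [])"
| "residual_words (p # K) m j =
     map ((#) p) (residual_words K m j) @ (if m = fst p then residual_words K (snd p) j else [])"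

text \<open>Each generator acts either on the first factor or on the rest. Proper generators are
  even, so no sign appears.\<close>

lemma pact_test_vector_Inl:
  "pact K (test_vector (j # js)) (Inl (Proper m) # w) =
     (\<Sum>K'\<leftarrow>residual_words K m j. pact K' (test_vector js) w)"
proof (induction K arbitrary: m w)
  case (Cons p K)
  obtain a b where p: "p = (a, b)"
    by (cases p)
  show ?case
    by (simp add: p Cons.IH eact_sum_list o_def)
qed simp

lemma pact_test_vector_Inr:
  "pact K (test_vector (j # js)) (Inr m # w) = (if m = j then pact K (test_vector js) w else 0)"
proof (induction K arbitrary: w)
  case (Cons p K)
  obtain a b where p: "p = (a, b)"
    by (cases p)
  show ?case
    by (simp add: p Cons.IH eact_zero)
qed simp

text \<open>The vanishing hypothesis leaves the residual words with no letter removed, which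
  requires \<open>m = j\<close>, and those with exactly one removed, which must be
  \<open>(m, j)\<close>.\<close>

lemma sum_residual_words:
  fixes \<phi> :: "('l \<times> 'l) list \<Rightarrow> complex"
  assumes "\<And>K'. length K' + 2 \<le> length K \<Longrightarrow> \<phi> K' = 0"
  shows "(\<Sum>K'\<leftarrow>residual_words K m j. \<phi> K') = (if m = j then \<phi> K else 0) +
    (\<Sum>r<length K. if K ! r = (m, j) then \<phi> (take r K @ drop (Suc r) K) else 0)"
  using assms
proof (induction K arbitrary: \<phi> m)
  case (Cons p K)
  obtain a b where p: "p = (a, b)"
    by (cases p)
  \<comment> \<open>With \<open>p\<close> already removed, any further removal makes two, so only
    the term keeping all of \<open>K\<close> survives.\<close>
  have "(\<Sum>K'\<leftarrow>residual_words K b j. \<phi> K') = (if b = j then \<phi> K else 0) +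
      (\<Sum>r<length K. if K ! r = (b, j) then \<phi> (take r K @ drop (Suc r) K) else 0)"
    by (rule Cons.IH) (simp add: Cons.prems)
  also have "(\<Sum>r<length K. if K ! r = (b, j) then \<phi> (take r K @ drop (Suc r) K) else 0) = 0"
    by (rule sum.neutral) (auto intro!: Cons.prems)
  finally have "(\<Sum>K'\<leftarrow>residual_words K b j. \<phi> K') = (if b = j then \<phi> K else 0)"
    by simp
  moreover have "(\<Sum>K'\<leftarrow>residual_words K m j. \<phi> (p # K')) = (if m = j then \<phi> (p # K) else 0) +
      (\<Sum>r<length K. if K ! r = (m, j) then \<phi> (p # take r K @ drop (Suc r) K) else 0)"
    by (rule Cons.IH) (simp add: Cons.prems)
  \<comment> \<open>In the sum for \<open>p # K\<close>, position 0 is the removal of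
    \<open>p\<close> itself; the other positions are shifted by one.\<close>
  ultimately show ?case
    by (cases "b = j") (simp_all add: p o_def sum.lessThan_Suc_shift del: sum.lessThan_Suc cong: if_cong)
qed simp

section \<open>Matrix coefficients of proper words\<close>

definition coef :: "('a, 'b, 'l) Ugl \<Rightarrow> ('l \<times> 'l) list \<Rightarrow> complex" where
  "coef u P = test_functional (map fst P) (rho u (test_vector (map snd P)))"

lemma coef_add: "coef (u + v) P = coef u P + coef v P"
  using test_functional_lincomb[of "map fst P" 1] by (simp add: coef_def rho_add)

lemma coef_scaleU: "coef (scaleU c u) P = c * coef u P"
  using test_functional_lincomb[of "map fst P" c _ "\<lambda>_. 0"] by (simp add: coef_def rho_scaleU)

lemma coef_0 [simp]: "coef 0 P = 0"
  by (simp add: coef_def)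

lemma coef_Irr: "u \<in> Irr \<Longrightarrow> coef u P = 0"
  by (simp add: coef_def rho_Irr content_test_vector)

text \<open>The trivial letter in the functional cancels the term that leaves the first factor
  untouched, and by the hypotheses words that lost two letters are too short to contribute. What
  remains is the removal of one letter equal to \<open>p\<close>.\<close>

lemma coef_pword_Cons:
  assumes "\<And>K'. length K' < length P \<Longrightarrow> coef (pword K' :: ('a, 'b, 'l) Ugl) P = 0"
    and "length K \<le> Suc (length P)"
  shows "coef (pword K :: ('a, 'b, 'l) Ugl) (p # P) =
    (\<Sum>r<length K. if K ! r = p then coef (pword (take r K @ drop (Suc r) K) :: ('a, 'b, 'l) Ugl) P else 0)"
proof -
  obtain i j where p: "p = (i, j)"
    by (cases p)
  have "(\<Sum>K'\<leftarrow>residual_words K i j. coef (pword K' :: ('a, 'b, 'l) Ugl) P) =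
      (if i = j then coef (pword K :: ('a, 'b, 'l) Ugl) P else 0) +
      (\<Sum>r<length K. if K ! r = (i, j) then coef (pword (take r K @ drop (Suc r) K) :: ('a, 'b, 'l) Ugl) P else 0)"
    by (rule sum_residual_words) (use assms in auto)
  moreover have "coef (pword K :: ('a, 'b, 'l) Ugl) (p # P) =
      (\<Sum>K'\<leftarrow>residual_words K i j. coef (pword K' :: ('a, 'b, 'l) Ugl) P) -
      (if i = j then coef (pword K :: ('a, 'b, 'l) Ugl) P else 0)"
    by (simp add: p coef_def rho_pword pact_test_vector_Inl pact_test_vector_Inr test_functional_sum_list)
  ultimately show ?thesis
    by (simp add: p)
qed

text \<open>With fewer generators than tensor factors some factor stays untouched, and the
  functional discards it.\<close>

lemma coef_pword_short: "length K < length P \<Longrightarrow> coef (pword K :: ('a, 'b, 'l) Ugl) P = 0"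
proof (induction P arbitrary: K)
  case (Cons p P)
  have "length (take r K @ drop (Suc r) K) < length P" if "r < length K" for r
    using that Cons.prems by auto
  then show ?case
    using coef_pword_Cons[of P K p, where 'a = 'a and 'b = 'b] Cons by (simp add: sum.neutral)
qed simp

text \<open>The strict bound makes \<open>Fil 0\<close> trivial, the starting point of the
  inductions on the degree.\<close>

definition Fil :: "nat \<Rightarrow> ('a, 'b, 'l) Ugl set" where
  "Fil d = Ugl.span (pword ` {K. length K < d})"

lemma pword_Fil: "length K < d \<Longrightarrow> pword K \<in> Fil d"
  by (auto simp: Fil_def intro: Ugl.span_base)

lemma Fil_mono: "d \<le> d' \<Longrightarrow> Fil d \<subseteq> Fil d'"
  unfolding Fil_def by (rule Ugl.span_mono) auto

lemma Fil_0: "Fil 0 = {0}"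
  by (simp add: Fil_def)

lemma Fil_mult_generator:
  assumes "x \<in> Fil d"
  shows "e_gl (Proper i) (Proper j) * x \<in> Fil (Suc d)"
  using assms unfolding Fil_def
proof (induction rule: Ugl.span_induct_alt)
  case base
  show ?case by (simp add: Ugl.span_zero)
next
  case (step c x y)
  then obtain K where K: "x = pword K" "length K < d"
    by blast
  have "e_gl (Proper i) (Proper j) * x = pword ((i, j) # K)"
    by (simp add: K pword_Cons)
  then have "e_gl (Proper i) (Proper j) * x \<in> Ugl.span (pword ` {K. length K < Suc d})"
    using K by (auto intro!: Ugl.span_base)
  then show ?case
    using step.IH by (simp add: distrib_left Ugl.span_add Ugl.span_scale)
qed

text \<open>Stated for left multiplication because membership in some \<open>Fil d\<close> alone
  would not pass through products in the induction.\<close>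

lemma Ugl_proper_mult_Fil: "x \<in> Ugl_proper \<Longrightarrow> \<exists>d. \<forall>n. \<forall>y \<in> Fil n. x * y \<in> Fil (n + d)"
proof (induction rule: Ugl_proper.induct)
  case (scalar c)
  then show ?case
    by (intro exI[of _ 0]) (simp add: Fil_def Ugl.span_scale)
next
  case (generator i j)
  then show ?case
    by (intro exI[of _ 1]) (simp add: Fil_mult_generator)
next
  case (add x y)
  then obtain d d' where d: "\<forall>n. \<forall>z \<in> Fil n. x * z \<in> Fil (n + d)" "\<forall>n. \<forall>z \<in> Fil n. y * z \<in> Fil (n + d')"
    by blast
  have "x * z \<in> Fil (n + (d + d'))" "y * z \<in> Fil (n + (d + d'))" if "z \<in> Fil n" for n z
    using that d Fil_mono[of "n + d" "n + (d + d')"] Fil_mono[of "n + d'" "n + (d + d')"] by auto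
  then show ?case
    by (intro exI[of _ "d + d'"]) (simp add: distrib_right Fil_def Ugl.span_add)
next
  case (mult x y)
  then obtain d d' where "\<forall>n. \<forall>z \<in> Fil n. x * z \<in> Fil (n + d)" "\<forall>n. \<forall>z \<in> Fil n. y * z \<in> Fil (n + d')"
    by blast
  then show ?case
    by (intro exI[of _ "d' + d"]) (metis add.assoc mult.assoc)
qed

lemma Ugl_proper_Fil: "x \<in> Ugl_proper \<Longrightarrow> \<exists>d. x \<in> Fil d"
  using Ugl_proper_mult_Fil[of x] pword_Fil[of "[]" 1] by fastforce

lemma e_gl_proper_commute:
  "e_gl (Proper i) (Proper j) * e_gl (Proper k) (Proper l) =
     e_gl (Proper k) (Proper l) * e_gl (Proper i) (Proper j) +
     ((if j = k then e_gl (Proper i) (Proper l) else 0) - (if i = l then e_gl (Proper k) (Proper j) else 0))"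
  by (simp add: e_commute[of "Proper i" "Proper j"])

text \<open>Exchanging neighbouring letters costs a commutator, which replaces two letters by at
  most one; the error therefore lies in words shorter than the two compared.\<close>

lemma pword_move_front:
  "pword (p # xs @ ys) - (pword (xs @ p # ys) :: ('a, 'b, 'l) Ugl) \<in> Fil (Suc (length (xs @ ys)))"
proof (induction xs)
  case Nil
  show ?case by (simp add: Fil_def Ugl.span_zero)
next
  case (Cons q xs)
  obtain i j k l where pq: "p = (i, j)" "q = (k, l)"
    by (cases p; cases q)
  \<comment> \<open>The commutator of the generators belonging to \<open>p\<close> and
    \<open>q\<close>.\<close>
  let ?c = "(if j = k then e_gl (Proper i) (Proper l) else 0) -
    (if i = l then e_gl (Proper k) (Proper j) else 0) :: ('a, 'b, 'l) Ugl"
  let ?D = "pword (p # xs @ ys) - pword (xs @ p # ys) :: ('a, 'b, 'l) Ugl"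
  have "(pword ((a, b) # xs @ ys) :: ('a, 'b, 'l) Ugl) \<in> Fil (Suc (length ((q # xs) @ ys)))" for a b
    by (rule pword_Fil) simp
  then have "?c * pword (xs @ ys) \<in> Fil (Suc (length ((q # xs) @ ys)))"
    by (auto simp: pword_Cons left_diff_distrib Fil_def Ugl.span_zero Ugl.span_neg intro!: Ugl.span_diff)
  moreover have "e_gl (Proper k) (Proper l) * ?D \<in> Fil (Suc (length ((q # xs) @ ys)))"
    using Fil_mult_generator[OF Cons.IH, of k l] by simp
  moreover have "pword (p # (q # xs) @ ys) - pword ((q # xs) @ p # ys) =
      ?c * pword (xs @ ys) + e_gl (Proper k) (Proper l) * ?D"
    by (simp add: pq pword_Cons e_gl_proper_commute[of i j k l] algebra_simps flip: mult.assoc)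
  ultimately show ?case
    unfolding Fil_def by (metis Ugl.span_add)
qed

lemma sum_lists_length_Suc:
  fixes f :: "'p::finite list \<Rightarrow> 'q::comm_monoid_add"
  shows "(\<Sum>P | length P = Suc d. f P) = (\<Sum>p\<in>UNIV. \<Sum>P | length P = d. f (p # P))"
proof -
  have eq: "{P :: 'p list. length P = Suc d} = (\<lambda>(p, P). p # P) ` (UNIV \<times> {P. length P = d})"
    by (auto simp: length_Suc_conv image_iff)
  show ?thesis
    unfolding eq by (subst sum.reindex)
      (auto simp: inj_on_def sum.cartesian_product o_def split_def)
qed

text \<open>In top degree the coefficient at \<open>P\<close> counts the matchings of the letters of
  \<open>K\<close> with those of \<open>P\<close>. The sum thus runs over all rearrangements of
  \<open>K\<close>, each equal to \<open>pword K\<close> up to shorter words.\<close>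

lemma sum_coef_pword:
  fixes K :: "('l::finite \<times> 'l) list"
  shows "(\<Sum>P | length P = length K. scaleU (coef (pword K :: ('a, 'b, 'l) Ugl) P) (pword P)) -
    scaleU (fact (length K)) (pword K :: ('a, 'b, 'l) Ugl) \<in> Fil (length K)"
proof (induction "length K" arbitrary: K)
  case 0
  then have "{P :: ('l \<times> 'l) list. length P = length K} = {[]}"
    by auto
  then show ?case
    using 0 by (simp add: coef_def Fil_0)
next
  case (Suc d K)
  let ?K = "\<lambda>r. take r K @ drop (Suc r) K"
  let ?e = "\<lambda>p. e_gl (Proper (fst p)) (Proper (snd p)) :: ('a, 'b, 'l) Ugl"
  let ?S = "\<lambda>K. \<Sum>P | length P = d. scaleU (coef (pword K :: ('a, 'b, 'l) Ugl) P) (pword P) :: ('a, 'b, 'l) Ugl"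
  have len: "length (?K r) = d" if "r < length K" for r
    using that Suc.hyps by simp
  have "(\<Sum>P | length P = length K. scaleU (coef (pword K :: ('a, 'b, 'l) Ugl) P) (pword P)) =
      (\<Sum>p\<in>UNIV. \<Sum>P | length P = d. scaleU (coef (pword K :: ('a, 'b, 'l) Ugl) (p # P)) (?e p * pword P))"
    by (simp add: sum_lists_length_Suc pword_Cons flip: Suc.hyps)
  \<comment> \<open>Here \<open>r\<close> is the position in \<open>K\<close> of the letter matched
    with the first letter \<open>p\<close>.\<close>
  also have "\<dots> = (\<Sum>p\<in>UNIV. \<Sum>P | length P = d. \<Sum>r<length K.
      if K ! r = p then scaleU (coef (pword (?K r) :: ('a, 'b, 'l) Ugl) P) (?e p * pword P) else 0)"
    using Suc.hyps
    by (intro sum.cong refl)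
      (auto simp: coef_pword_Cons coef_pword_short Ugl.scale_sum_left intro!: sum.cong)
  also have "\<dots> = (\<Sum>r<length K. \<Sum>P | length P = d. \<Sum>p\<in>UNIV.
      if K ! r = p then scaleU (coef (pword (?K r) :: ('a, 'b, 'l) Ugl) P) (?e p * pword P) else 0)"
    by (subst (2) sum.swap, subst sum.swap, subst (2) sum.swap) (rule refl)
  also have "\<dots> = (\<Sum>r<length K. ?e (K ! r) * ?S (?K r))"
    by (simp add: sum_distrib_left)
  finally have *: "(\<Sum>P | length P = length K. scaleU (coef (pword K :: ('a, 'b, 'l) Ugl) P) (pword P)) =
      (\<Sum>r<length K. ?e (K ! r) * ?S (?K r))" .
  \<comment> \<open>Two errors of lower degree arise: one from the induction hypothesis for the
    shortened word, one from moving \<open>K ! r\<close> back to its place.\<close>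
  have summand: "?e (K ! r) * ?S (?K r) - scaleU (fact d) (pword K) \<in> Fil (length K)" if r: "r < length K" for r
  proof -
    have "?e (K ! r) * (?S (?K r) - scaleU (fact d) (pword (?K r))) \<in> Fil (length K)"
      using Fil_mult_generator[OF Suc.hyps(1)[OF len[OF r, symmetric]]]
      unfolding len[OF r] Suc.hyps(2) by simp
    moreover have "pword (K ! r # ?K r) - pword K \<in> Fil (length K)"
      using pword_move_front[of "K ! r" "take r K" "drop (Suc r) K"]
      unfolding len[OF r] Suc.hyps(2) by (simp flip: id_take_nth_drop[OF r])
    ultimately have "?e (K ! r) * (?S (?K r) - scaleU (fact d) (pword (?K r))) +
        scaleU (fact d) (pword (K ! r # ?K r) - pword K) \<in> Fil (length K)"
      unfolding Fil_def by (intro Ugl.span_add Ugl.span_scale)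
    then show ?thesis
      by (simp add: pword_Cons right_diff_distrib Ugl.scale_right_diff_distrib)
  qed
  have "(\<Sum>r<length K. ?e (K ! r) * ?S (?K r) - scaleU (fact d) (pword K)) \<in> Fil (length K)"
    using summand unfolding Fil_def by (intro Ugl.span_sum) auto
  also have "(\<Sum>r<length K. ?e (K ! r) * ?S (?K r) - scaleU (fact d) (pword K)) =
      (\<Sum>r<length K. ?e (K ! r) * ?S (?K r)) - scaleU (fact (length K)) (pword K)"
    using scaleU_of_nat[of "length K" "scaleU (fact d) (pword K) :: ('a, 'b, 'l) Ugl"]
    by (simp add: sum_subtractf fact_Suc flip: Suc.hyps(2))
  finally show ?case
    by (simp only: *)
qed

text \<open>By \<open>top\<close>, the coefficients of an element of \<open>Fil (Suc d)\<close>
  recover \<open>fact d\<close> times that element modulo \<open>Fil d\<close>. Vanishing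
  coefficients therefore push \<open>u\<close> down one degree at a time.\<close>

lemma Fil_eq_0:
  fixes u :: "('a, 'b, 'l::finite) Ugl"
  assumes "u \<in> Fil d" and "\<And>P. coef u P = 0"
  shows "u = 0"
  using assms(1)
proof (induction d)
  case 0
  then show ?case by (simp add: Fil_0)
next
  case (Suc d)
  have top: "(\<Sum>P | length P = d. scaleU (coef v P) (pword P)) - scaleU (fact d) v \<in> Fil d"
    if "v \<in> Fil (Suc d)" for v :: "('a, 'b, 'l) Ugl"
    using that unfolding Fil_def[of "Suc d"]
  proof (induction rule: Ugl.span_induct_alt)
    case base
    show ?case by (simp add: Fil_def Ugl.span_zero)
  next
    case (step c x y)
    then obtain K where K: "x = pword K" "length K < Suc d"
      by blast
    have "(\<Sum>P | length P = d. scaleU (coef x P) (pword P)) - scaleU (fact d) x \<in> Fil d"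
    proof (cases "length K = d")
      case True
      then show ?thesis
        using sum_coef_pword[of K] by (simp add: K)
    next
      case False
      then have "length K < d"
        using K(2) by simp
      then have "x \<in> Fil d"
        by (simp add: K pword_Fil)
      then have "scaleU (fact d) x \<in> Fil d"
        unfolding Fil_def by (rule Ugl.span_scale)
      moreover have "(\<Sum>P | length P = d. scaleU (coef x P) (pword P)) = (0 :: ('a, 'b, 'l) Ugl)"
        using \<open>length K < d\<close> by (intro sum.neutral) (auto simp: K coef_pword_short)
      ultimately show ?thesis
        using Ugl.span_neg[of "scaleU (fact d) x"] unfolding Fil_def by simp
    qed
    then have "scaleU c ((\<Sum>P | length P = d. scaleU (coef x P) (pword P)) - scaleU (fact d) x) +
        ((\<Sum>P | length P = d. scaleU (coef y P) (pword P)) - scaleU (fact d) y) \<in> Fil d"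
      using step.IH unfolding Fil_def by (intro Ugl.span_add Ugl.span_scale)
    also have "scaleU c ((\<Sum>P | length P = d. scaleU (coef x P) (pword P)) - scaleU (fact d) x) +
        ((\<Sum>P | length P = d. scaleU (coef y P) (pword P)) - scaleU (fact d) y) =
        (\<Sum>P | length P = d. scaleU (coef (scaleU c x + y) P) (pword P)) - scaleU (fact d) (scaleU c x + y)"
      by (simp add: coef_add coef_scaleU scaleU_add_left scaleU_add_right sum.distrib
          Ugl.scale_right_diff_distrib Ugl.scale_sum_right mult.commute)
    finally show ?case .
  qed
  have "- scaleU (fact d) u \<in> Fil d"
    using top[OF Suc.prems] assms(2) by simp
  then have "scaleU (- 1 / fact d) (- scaleU (fact d) u :: ('a, 'b, 'l) Ugl) \<in> Fil d"
    unfolding Fil_def by (rule Ugl.span_scale)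
  then show ?case
    using Suc.IH by simp
qed

text \<open>Test vectors contain no virtual symbol, so all coefficients vanish on
  \<open>Irr\<close>, while they separate the elements of the proper part.\<close>

lemma Ugl_proper_Irr_trivial:
  fixes u :: "('a, 'b, 'l::finite) Ugl"
  assumes "u \<in> Ugl_proper" and "u \<in> Irr"
  shows "u = 0"
  using assms Ugl_proper_Fil Fil_eq_0 coef_Irr by metis

section \<open>The ideal of irregular elements\<close>

lemma Irr_add:
  assumes "x \<in> Irr" and "y \<in> Irr"
  shows "x + y \<in> Irr"
  using assms(2,1)
proof (induction y rule: Irr.induct)
  case (step u w z)
  then show ?case
    using Irr.step[of "x + u" w z] by (simp add: add.assoc)
qed simp

lemma Irr_mult_left: "x \<in> Irr \<Longrightarrow> y * x \<in> Irr"
proof (induction rule: Irr.induct)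
  case (step u w z)
  then show ?case
    using Irr.step[of "y * u" w "y * z"] by (simp add: distrib_left mult.assoc)
qed (simp add: Irr.zero)

lemma Irr_scaleU: "x \<in> Irr \<Longrightarrow> scaleU c x \<in> Irr"
  using Irr_mult_left[of x "scaleU c 1"] by simp

lemma Irr_uminus: "x \<in> Irr \<Longrightarrow> - x \<in> Irr"
  using Irr_mult_left[of x "- 1"] by simp

lemma Irr_diff: "x \<in> Irr \<Longrightarrow> y \<in> Irr \<Longrightarrow> x - y \<in> Irr"
  using Irr_add[of x "- y"] Irr_uminus by auto

lemma Irr_sum: "(\<And>i. i \<in> I \<Longrightarrow> f i \<in> Irr) \<Longrightarrow> sum f I \<in> Irr"
  by (induction I rule: infinite_finite_induct) (auto simp: Irr.zero Irr_add)

lemma Irr_e_word: "irregular w \<Longrightarrow> e_word w \<in> Irr"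
  using Irr.step[OF Irr.zero, of w 1] by simp

text \<open>The leftmost letter asks for a \<open>\<gamma>\<close> that no letter of
  \<open>w\<close> creates.\<close>

lemma Irr_annihilation:
  assumes "virtual \<gamma>" and "\<gamma> \<notin> fst ` set w"
  shows "e_gl a \<gamma> * e_word w \<in> Irr"
proof -
  have "irregular ([] @ (a, \<gamma>) # w)"
    using assms unfolding irregular_iff by (intro exI conjI) (auto simp: count_list_0_iff)
  then show ?thesis
    using Irr_e_word by (fastforce simp: e_word_def)
qed

text \<open>Appending a proper letter changes no count of virtual symbols, so irregular words stay
  irregular. This is used to put commutators into \<open>Irr\<close> in the proof of
  centrality.\<close>

lemma Irr_mult_right:
  assumes "x \<in> Irr"
  shows "x * e_gl (Proper i) (Proper j) \<in> Irr"
  using assms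
proof (induction rule: Irr.induct)
  case (step u w z)
  obtain u' p v \<gamma> where w: "w = u' @ p # v" "virtual \<gamma>"
      "count_list (map snd (p # v)) \<gamma> > count_list (map fst v) \<gamma>"
    using step.hyps(2) irregular_iff by blast
  have "irregular (u' @ p # v @ [(Proper i, Proper j)])"
    unfolding irregular_iff using w(2,3)
    by (intro exI[of _ u'] exI[of _ p] exI[of _ "v @ [(Proper i, Proper j)]"] exI[of _ \<gamma>]) auto
  then have "u * e_gl (Proper i) (Proper j) + z * e_word (w @ [(Proper i, Proper j)]) \<in> Irr"
    using step.IH Irr.step w(1) by auto
  then show ?case
    by (simp add: e_word_def distrib_right mult.assoc)
qed (simp add: Irr.zero)

lemma Ugl_proper_scaleU: "x \<in> Ugl_proper \<Longrightarrow> scaleU c x \<in> Ugl_proper"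
  using Ugl_proper.mult[OF Ugl_proper.scalar, of x c] by simp

lemma Ugl_proper_diff: "x \<in> Ugl_proper \<Longrightarrow> y \<in> Ugl_proper \<Longrightarrow> x - y \<in> Ugl_proper"
  using Ugl_proper.add[of x "scaleU (- 1) y"] Ugl_proper_scaleU[of y "- 1"] by simp

lemma Ugl_proper_0: "0 \<in> Ugl_proper"
  using Ugl_proper.scalar[of 0] by simp

lemma Ugl_proper_sum: "(\<And>i. i \<in> I \<Longrightarrow> f i \<in> Ugl_proper) \<Longrightarrow> sum f I \<in> Ugl_proper"
  by (induction I rule: infinite_finite_induct) (auto simp: Ugl_proper_0 Ugl_proper.add)

text \<open>Since the proper part meets \<open>Irr\<close> trivially, exhibiting a proper element
  congruent to \<open>x\<close> suffices; all devirtualizations below are computed in this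
  way.\<close>

lemma devirt_eqI:
  fixes u :: "('a, 'b, 'l::finite) Ugl"
  assumes "u \<in> Ugl_proper" and "x - u \<in> Irr"
  shows "devirt x = u"
  unfolding devirt_def
proof (rule the_equality)
  fix v
  assume v: "v \<in> Ugl_proper \<and> x - v \<in> Irr"
  then have "v - u \<in> Irr"
    using Irr_diff[OF assms(2), of "x - v"] by simp
  then have "v - u = 0"
    using Ugl_proper_Irr_trivial[of "v - u"] Ugl_proper_diff v assms(1) by blast
  then show "v = u"
    by simp
qed (use assms in simp)

section \<open>Weights of the diagonal generators\<close>

lemma e_diag_commute:
  "e_gl a a * e_gl c d = e_gl c d * e_gl a a + scaleU (of_bool (a = c) - of_bool (a = d)) (e_gl c d)"
  by (auto simp: e_commute[of a a] minus_one_power_iff algebra_simps)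

lemma e_diag_word:
  "e_gl a a * e_word w =
    e_word w * e_gl a a + scaleU (of_nat (count_list (map fst w) a) - of_nat (count_list (map snd w) a)) (e_word w)"
proof (induction w)
  case (Cons p w)
  obtain c d where p: "p = (c, d)"
    by (cases p)
  have "e_gl a a * e_word (p # w) =
      e_gl c d * (e_gl a a * e_word w) + scaleU (of_bool (a = c) - of_bool (a = d)) (e_word (p # w))"
    by (simp add: p e_word_def e_diag_commute distrib_right flip: mult.assoc)
  also have "\<dots> = e_word (p # w) * e_gl a a +
      scaleU (of_nat (count_list (map fst w) a) - of_nat (count_list (map snd w) a) +
        (of_bool (a = c) - of_bool (a = d))) (e_word (p # w))"
    unfolding Cons.IH
    by (simp only: scaleU_add_left) (simp add: p e_word_def distrib_left mult.assoc)
  also have "of_nat (count_list (map fst w) a) - of_nat (count_list (map snd w) a) +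
      (of_bool (a = c) - of_bool (a = d)) =
      (of_nat (count_list (map fst (p # w)) a) - of_nat (count_list (map snd (p # w)) a) :: complex)"
    by (simp add: p)
  finally show ?case .
qed (simp add: e_word_def)

text \<open>Once moved to the right end, \<open>e_gl a a\<close> is itself an irregular word, so
  only the weight of \<open>w\<close> remains.\<close>

lemma e_diag_word_Irr:
  assumes "virtual a"
  shows "e_gl a a * e_word w -
    scaleU (of_nat (count_list (map fst w) a) - of_nat (count_list (map snd w) a)) (e_word w) \<in> Irr"
  using Irr_mult_left[OF Irr_annihilation[OF assms, of "[]" a], of "e_word w"]
  by (simp add: e_diag_word) (simp add: e_word_def)

section \<open>Devirtualization of Capelli-type products\<close>

text \<open>
  Treating all \<open>\<gamma>\<close> at once makes the devirtualized element independent of the virtual symbol.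
\<close>

inductive raising_family :: "nat \<Rightarrow> ('a \<Rightarrow> ('a, 'b, 'l) Ugl) \<Rightarrow> bool" where
  one: "raising_family 0 (\<lambda>_. 1)"
| zero: "raising_family k (\<lambda>_. 0)"
| raise: "raising_family k f \<Longrightarrow> raising_family (Suc k) (\<lambda>\<gamma>. e_gl (Pos \<gamma>) (Proper i) * f \<gamma>)"
| proper: "raising_family k f \<Longrightarrow> raising_family k (\<lambda>\<gamma>. e_gl (Proper i) (Proper j) * f \<gamma>)"
| add: "raising_family k f \<Longrightarrow> raising_family k g \<Longrightarrow> raising_family k (\<lambda>\<gamma>. f \<gamma> + g \<gamma>)"
| scale: "raising_family k f \<Longrightarrow> raising_family k (\<lambda>\<gamma>. scaleU c (f \<gamma>))"

text \<open>At level 0 no raising letter occurs, hence nothing depends on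
  \<open>\<gamma>\<close>.\<close>

lemma raising_family_0:
  assumes "raising_family 0 f"
  shows "\<exists>u\<in>Ugl_proper. \<forall>\<gamma>. f \<gamma> = u"
  using assms
proof (induction "0 :: nat" f rule: raising_family.induct)
  case one
  then show ?case
    using Ugl_proper.scalar[of 1] by auto
qed (auto simp: Ugl_proper_0 Ugl_proper.add Ugl_proper.mult Ugl_proper.generator Ugl_proper_scaleU)

text \<open>Each raising letter has weight 1 in \<open>\<gamma>\<close> and each proper letter
  weight 0, so the level \<open>k\<close> is the weight modulo \<open>Irr\<close>.\<close>

lemma raising_family_weight:
  "raising_family k f \<Longrightarrow> e_gl (Pos \<gamma>) (Pos \<gamma>) * f \<gamma> - scaleU (of_nat k) (f \<gamma>) \<in> Irr"
proof (induction rule: raising_family.induct)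
  case one
  then show ?case
    using Irr_annihilation[of "Pos \<gamma>" "[]" "Pos \<gamma>"] by (simp add: e_word_def)
next
  case (raise k f i)
  have "e_gl (Pos \<gamma>) (Pos \<gamma>) * (e_gl (Pos \<gamma>) (Proper i) * f \<gamma>) -
      scaleU (of_nat (Suc k)) (e_gl (Pos \<gamma>) (Proper i) * f \<gamma>) =
      e_gl (Pos \<gamma>) (Proper i) * (e_gl (Pos \<gamma>) (Pos \<gamma>) * f \<gamma> - scaleU (of_nat k) (f \<gamma>))"
    by (simp add: e_diag_commute scaleU_add_left algebra_simps flip: mult.assoc)
  then show ?case
    using Irr_mult_left[OF raise.IH] by metis
next
  case (proper k f i j)
  have "e_gl (Pos \<gamma>) (Pos \<gamma>) * (e_gl (Proper i) (Proper j) * f \<gamma>) -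
      scaleU (of_nat k) (e_gl (Proper i) (Proper j) * f \<gamma>) =
      e_gl (Proper i) (Proper j) * (e_gl (Pos \<gamma>) (Pos \<gamma>) * f \<gamma> - scaleU (of_nat k) (f \<gamma>))"
    by (simp add: e_diag_commute algebra_simps flip: mult.assoc)
  then show ?case
    using Irr_mult_left[OF proper.IH] by metis
next
  case (add k f g)
  then show ?case
    using Irr_add[OF add.IH] by (simp add: scaleU_add_right algebra_simps)
next
  case (scale k f c)
  then show ?case
    using Irr_scaleU[OF scale.IH, of c] by (simp add: Ugl.scale_right_diff_distrib mult.commute)
qed (simp add: Irr.zero)

lemma lowering_raising:
  "e_gl (Proper j) (Pos \<gamma>) * e_gl (Pos \<gamma>) (Proper i) =
    e_gl (Proper j) (Proper i) + scaleU (of_bool (i = j)) (e_gl (Pos \<gamma>) (Pos \<gamma>)) -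
    e_gl (Pos \<gamma>) (Proper i) * e_gl (Proper j) (Pos \<gamma>)"
  by (simp add: e_commute[of "Proper j" "Pos \<gamma>"])

lemma lowering_proper:
  "e_gl (Proper j) (Pos \<gamma>) * e_gl (Proper a) (Proper b) =
    e_gl (Proper a) (Proper b) * e_gl (Proper j) (Pos \<gamma>) - scaleU (of_bool (j = b)) (e_gl (Proper a) (Pos \<gamma>))"
  by (simp add: e_commute[of "Proper j" "Pos \<gamma>"])

text \<open>The lowering letter is moved to the right. It merges with a raising letter into a proper
  one, or turns into a diagonal generator that acts as a scalar, or reaches the right end, where it
  is irregular. In the first two cases one raising letter is used up.\<close>

lemma raising_family_lower:
  assumes "raising_family k f"
  shows "\<exists>g. (\<forall>\<gamma>. e_gl (Proper j) (Pos \<gamma>) * f \<gamma> - g \<gamma> \<in> Irr) \<and>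
    (case k of 0 \<Rightarrow> g = (\<lambda>_. 0) | Suc m \<Rightarrow> raising_family m g)"
  using assms
proof (induction arbitrary: j rule: raising_family.induct)
  case one
  then show ?case
    using Irr_annihilation[of "Pos _" "[]"] by (auto simp: e_word_def)
next
  case (zero k)
  then show ?case
    by (intro exI[of _ "\<lambda>_. 0"]) (auto simp: Irr.zero raising_family.zero split: nat.split)
next
  case (raise k f i)
  obtain g where g: "\<And>\<gamma>. e_gl (Proper j) (Pos \<gamma>) * f \<gamma> - g \<gamma> \<in> Irr"
      "case k of 0 \<Rightarrow> g = (\<lambda>_. 0) | Suc m \<Rightarrow> raising_family m g"
    using raise.IH[of j] by blast
  \<comment> \<open>This is \<open>lowering_raising\<close> applied to \<open>f \<gamma>\<close>,
    with the diagonal generator replaced by its weight \<open>k\<close> and the lowered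
    \<open>f \<gamma>\<close> by \<open>g \<gamma>\<close>.\<close>
  define h where "h = (\<lambda>\<gamma>. (e_gl (Proper j) (Proper i) * f \<gamma> + scaleU (of_bool (i = j) * of_nat k) (f \<gamma>)) +
    scaleU (- 1) (e_gl (Pos \<gamma>) (Proper i) * g \<gamma>))"
  \<comment> \<open>For \<open>k = 0\<close> the family \<open>g\<close> vanishes and the product is
    the zero family.\<close>
  have "raising_family k (\<lambda>\<gamma>. e_gl (Pos \<gamma>) (Proper i) * g \<gamma>)"
    using g(2) raising_family.raise[of _ g i] by (cases k) (auto intro: raising_family.zero)
  then have "raising_family k h"
    unfolding h_def using raise.hyps
    by (intro raising_family.add raising_family.proper raising_family.scale)
  moreover have "e_gl (Proper j) (Pos \<gamma>) * (e_gl (Pos \<gamma>) (Proper i) * f \<gamma>) - h \<gamma> \<in> Irr" for \<gamma>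
  proof -
    have "scaleU (of_bool (i = j)) (e_gl (Pos \<gamma>) (Pos \<gamma>) * f \<gamma> - scaleU (of_nat k) (f \<gamma>)) -
        e_gl (Pos \<gamma>) (Proper i) * (e_gl (Proper j) (Pos \<gamma>) * f \<gamma> - g \<gamma>) \<in> Irr"
      by (intro Irr_diff Irr_scaleU raising_family_weight raise.hyps Irr_mult_left g)
    also have "scaleU (of_bool (i = j)) (e_gl (Pos \<gamma>) (Pos \<gamma>) * f \<gamma> - scaleU (of_nat k) (f \<gamma>)) -
        e_gl (Pos \<gamma>) (Proper i) * (e_gl (Proper j) (Pos \<gamma>) * f \<gamma> - g \<gamma>) =
        e_gl (Proper j) (Pos \<gamma>) * (e_gl (Pos \<gamma>) (Proper i) * f \<gamma>) - h \<gamma>"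
      unfolding mult.assoc[symmetric] lowering_raising
      by (simp add: h_def Ugl.scale_right_diff_distrib algebra_simps)
    finally show ?thesis .
  qed
  ultimately show ?case
    by (intro exI[of _ h]) simp
next
  case (proper k f a b)
  \<comment> \<open>Passing a proper letter can change the lowering index from \<open>j\<close> to
    \<open>a\<close>, so the induction hypothesis is needed for both.\<close>
  obtain g where g: "\<And>j \<gamma>. e_gl (Proper j) (Pos \<gamma>) * f \<gamma> - g j \<gamma> \<in> Irr"
      "\<And>j. case k of 0 \<Rightarrow> g j = (\<lambda>_. 0) | Suc m \<Rightarrow> raising_family m (g j)"
    using proper.IH by metis
  define h where "h = (\<lambda>\<gamma>. e_gl (Proper a) (Proper b) * g j \<gamma> + scaleU (- of_bool (j = b)) (g a \<gamma>))"
  have "case k of 0 \<Rightarrow> h = (\<lambda>_. 0) | Suc m \<Rightarrow> raising_family m h"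
    using g(2)[of j] g(2)[of a] unfolding h_def
    by (cases k) (auto simp del: Ugl.scale_minus_left intro!: raising_family.add raising_family.proper raising_family.scale)
  moreover have "e_gl (Proper j) (Pos \<gamma>) * (e_gl (Proper a) (Proper b) * f \<gamma>) - h \<gamma> \<in> Irr" for \<gamma>
  proof -
    have "e_gl (Proper a) (Proper b) * (e_gl (Proper j) (Pos \<gamma>) * f \<gamma> - g j \<gamma>) -
        scaleU (of_bool (j = b)) (e_gl (Proper a) (Pos \<gamma>) * f \<gamma> - g a \<gamma>) \<in> Irr"
      by (intro Irr_diff Irr_scaleU Irr_mult_left g)
    also have "e_gl (Proper a) (Proper b) * (e_gl (Proper j) (Pos \<gamma>) * f \<gamma> - g j \<gamma>) -
        scaleU (of_bool (j = b)) (e_gl (Proper a) (Pos \<gamma>) * f \<gamma> - g a \<gamma>) =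
        e_gl (Proper j) (Pos \<gamma>) * (e_gl (Proper a) (Proper b) * f \<gamma>) - h \<gamma>"
      unfolding mult.assoc[symmetric] lowering_proper
      by (simp add: h_def Ugl.scale_right_diff_distrib algebra_simps)
    finally show ?thesis .
  qed
  ultimately show ?case
    by blast
next
  case (add k f f')
  obtain g g' where g: "\<And>\<gamma>. e_gl (Proper j) (Pos \<gamma>) * f \<gamma> - g \<gamma> \<in> Irr"
      "case k of 0 \<Rightarrow> g = (\<lambda>_. 0) | Suc m \<Rightarrow> raising_family m g"
      "\<And>\<gamma>. e_gl (Proper j) (Pos \<gamma>) * f' \<gamma> - g' \<gamma> \<in> Irr"
      "case k of 0 \<Rightarrow> g' = (\<lambda>_. 0) | Suc m \<Rightarrow> raising_family m g'"
    using add.IH by metis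
  have "e_gl (Proper j) (Pos \<gamma>) * (f \<gamma> + f' \<gamma>) - (g \<gamma> + g' \<gamma>) \<in> Irr" for \<gamma>
    using Irr_add[OF g(1)[of \<gamma>] g(3)[of \<gamma>]] by (simp add: algebra_simps)
  moreover have "case k of 0 \<Rightarrow> (\<lambda>\<gamma>. g \<gamma> + g' \<gamma>) = (\<lambda>_. 0) | Suc m \<Rightarrow> raising_family m (\<lambda>\<gamma>. g \<gamma> + g' \<gamma>)"
    using g(2,4) by (cases k) (auto intro: raising_family.add)
  ultimately show ?case
    by (intro exI[of _ "\<lambda>\<gamma>. g \<gamma> + g' \<gamma>"]) simp
next
  case (scale k f c)
  obtain g where g: "\<And>\<gamma>. e_gl (Proper j) (Pos \<gamma>) * f \<gamma> - g \<gamma> \<in> Irr"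
      "case k of 0 \<Rightarrow> g = (\<lambda>_. 0) | Suc m \<Rightarrow> raising_family m g"
    using scale.IH by metis
  have "e_gl (Proper j) (Pos \<gamma>) * scaleU c (f \<gamma>) - scaleU c (g \<gamma>) \<in> Irr" for \<gamma>
    using Irr_scaleU[OF g(1), of c] by (simp add: Ugl.scale_right_diff_distrib)
  moreover have "case k of 0 \<Rightarrow> (\<lambda>\<gamma>. scaleU c (g \<gamma>)) = (\<lambda>_. 0) | Suc m \<Rightarrow> raising_family m (\<lambda>\<gamma>. scaleU c (g \<gamma>))"
    using g(2) by (cases k) (auto intro: raising_family.scale)
  ultimately show ?case
    by (intro exI[of _ "\<lambda>\<gamma>. scaleU c (g \<gamma>)"]) simp
qed

abbreviation lowering :: "'a \<Rightarrow> 'l list \<Rightarrow> ('a, 'b, 'l) Ugl" where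
  "lowering \<gamma> js \<equiv> prod_list (map (\<lambda>j. e_gl (Proper j) (Pos \<gamma>)) js)"

abbreviation raising :: "'a \<Rightarrow> 'l list \<Rightarrow> ('a, 'b, 'l) Ugl" where
  "raising \<gamma> js \<equiv> prod_list (map (\<lambda>j. e_gl (Pos \<gamma>) (Proper j)) js)"

text \<open>The rightmost lowering letter acts first, hence the induction from the end of the list;
  each one reduces the level by one until \<open>raising_family_0\<close> applies.\<close>

lemma lowering_raising_family:
  assumes "raising_family (length js) f"
  shows "\<exists>u\<in>Ugl_proper. \<forall>\<gamma>. lowering \<gamma> js * f \<gamma> - u \<in> Irr"
  using assms
proof (induction js arbitrary: f rule: rev_induct)
  case Nil
  then obtain u where "u \<in> Ugl_proper" "\<And>\<gamma>. f \<gamma> = u"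
    using raising_family_0[of f] by auto
  then show ?case
    by (intro bexI[of _ u]) (simp_all add: Irr.zero)
next
  case (snoc j js)
  obtain g where g: "\<And>\<gamma>. e_gl (Proper j) (Pos \<gamma>) * f \<gamma> - g \<gamma> \<in> Irr" "raising_family (length js) g"
    using raising_family_lower[OF snoc.prems, of j] by auto
  obtain u where u: "u \<in> Ugl_proper" "\<And>\<gamma>. lowering \<gamma> js * g \<gamma> - u \<in> Irr"
    using snoc.IH[OF g(2)] by blast
  have "lowering \<gamma> (js @ [j]) * f \<gamma> - u \<in> Irr" for \<gamma>
    using Irr_add[OF Irr_mult_left[OF g(1)[of \<gamma>], of "lowering \<gamma> js"] u(2)[of \<gamma>]]
    by (simp add: algebra_simps)
  then show ?case
    using u(1) by blast
qed

text \<open>Choosing \<open>u\<close> before \<open>\<gamma>\<close> allows products with different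
  virtual symbols to be compared.\<close>

lemma lowering_raising_Virt:
  assumes "length js = length is"
  shows "\<exists>u\<in>Ugl_proper. \<forall>\<gamma>. lowering \<gamma> js * raising \<gamma> is - u \<in> Irr"
proof (rule lowering_raising_family)
  show "raising_family (length js) (\<lambda>\<gamma>. raising \<gamma> is)"
    unfolding assms by (induction "is") (simp_all add: raising_family.one raising_family.raise)
qed

text \<open>The head \<open>b\<close> belongs to the innermost pair. By distinctness no letter to
  its right creates \<open>Neg b\<close>, so in the commutation of the pair only the diagonal
  generator of \<open>\<gamma>\<close> survives, with weight \<open>length is - length bs\<close>
  for the tail \<open>bs\<close>. The product of these weights is the falling factorial.\<close>

lemma polarization_round_trip:
  fixes \<gamma> :: 'a and bs :: "'b list" and "is" :: "'l list"
  assumes "distinct bs" and "length bs \<le> length is"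
  shows "prod_list (map (\<lambda>b. e_gl (Pos \<gamma>) (Neg b)) (rev bs)) *
      prod_list (map (\<lambda>b. e_gl (Neg b) (Pos \<gamma>)) bs) * raising \<gamma> is -
    scaleU (fact (length is) / fact (length is - length bs)) (raising \<gamma> is :: ('a, 'b, 'l) Ugl) \<in> Irr"
  using assms
proof (induction bs)
  case Nil
  then show ?case
    by (simp add: Irr.zero)
next
  case (Cons b bs)
  let ?w = "map (\<lambda>b. (Neg b, Pos \<gamma>)) bs @ map (\<lambda>j. (Pos \<gamma>, Proper j)) is"
  let ?y = "e_word ?w :: ('a, 'b, 'l) Ugl"
  let ?q = "prod_list (map (\<lambda>b. e_gl (Pos \<gamma>) (Neg b)) (rev bs)) :: ('a, 'b, 'l) Ugl"
  have y: "?y = prod_list (map (\<lambda>b. e_gl (Neg b) (Pos \<gamma>)) bs) * raising \<gamma> is"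
    by (simp add: e_word_def o_def)
  have counts: "count_list (map fst ?w) (Pos \<gamma>) = length is" "count_list (map snd ?w) (Pos \<gamma>) = length bs"
    by (induction bs; induction "is"; simp)+
  have coeff: "of_nat (count_list (map fst ?w) (Pos \<gamma>)) - of_nat (count_list (map snd ?w) (Pos \<gamma>)) =
      (of_nat (length is - length bs) :: complex)"
    unfolding counts using Cons.prems by (simp add: of_nat_diff)
  have weight: "e_gl (Pos \<gamma>) (Pos \<gamma>) * ?y - scaleU (of_nat (length is - length bs)) ?y \<in> Irr"
    using e_diag_word_Irr[of "Pos \<gamma>" ?w] unfolding coeff by simp
  have "Neg b \<notin> fst ` set ?w"
    using Cons.prems by auto
  then have kill: "e_gl a (Neg b) * ?y \<in> Irr" for a
    by (rule Irr_annihilation[rotated]) simp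
  have swap: "e_gl (Pos \<gamma>) (Neg b) * e_gl (Neg b) (Pos \<gamma>) =
      e_gl (Pos \<gamma>) (Pos \<gamma>) + (e_gl (Neg b) (Neg b) - e_gl (Neg b) (Pos \<gamma>) * e_gl (Pos \<gamma>) (Neg b))"
    by (simp add: e_commute[of "Pos \<gamma>" "Neg b"])
  have "e_gl (Pos \<gamma>) (Neg b) * (e_gl (Neg b) (Pos \<gamma>) * ?y) - scaleU (of_nat (length is - length bs)) ?y =
      (e_gl (Pos \<gamma>) (Pos \<gamma>) * ?y - scaleU (of_nat (length is - length bs)) ?y) +
      (e_gl (Neg b) (Neg b) * ?y - e_gl (Neg b) (Pos \<gamma>) * (e_gl (Pos \<gamma>) (Neg b) * ?y))"
    unfolding mult.assoc[symmetric] swap by (simp add: algebra_simps)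
  also have "\<dots> \<in> Irr"
    by (intro Irr_add weight Irr_diff Irr_mult_left kill)
  finally have "?q * (e_gl (Pos \<gamma>) (Neg b) * (e_gl (Neg b) (Pos \<gamma>) * ?y) - scaleU (of_nat (length is - length bs)) ?y) \<in> Irr"
    by (rule Irr_mult_left)
  moreover have "scaleU (of_nat (length is - length bs))
      (?q * ?y - scaleU (fact (length is) / fact (length is - length bs)) (raising \<gamma> is)) \<in> Irr"
    using Cons.IH Cons.prems by (intro Irr_scaleU) (simp add: y mult.assoc)
  moreover have "of_nat (length is - length bs) * (fact (length is) / fact (length is - length bs)) =
      (fact (length is) / fact (length is - Suc (length bs)) :: complex)"
  proof -
    have "length is - length bs = Suc (length is - Suc (length bs))"
      using Cons.prems by simp
    then show ?thesis
      by (simp add: field_simps)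
  qed
  ultimately show ?case
    using Irr_add by (fastforce simp: y mult.assoc Ugl.scale_right_diff_distrib right_diff_distrib)
qed

section \<open>Anticommuting products\<close>

lemma mult_minus_one_power: "x * ((-1) ^ n * y) = (-1) ^ n * (x * y :: 'r::ring_1)"
  by (cases "even n") simp_all

lemma prod_list_anticommute:
  fixes f :: "'i \<Rightarrow> 'r::ring_1"
  assumes "\<And>x y. f x * f y = - (f y * f x)"
  shows "f x * prod_list (map f ys) = (-1) ^ length ys * (prod_list (map f ys) * f x)"
proof (induction ys)
  case (Cons y ys)
  have "f x * prod_list (map f (y # ys)) = - (f y * (f x * prod_list (map f ys)))"
    using assms[of x y] by (simp flip: mult.assoc)
  then show ?case
    by (simp add: Cons.IH mult_minus_one_power mult.assoc)
qed simp

text \<open>The sign depends only on the rearrangement, so one exponent serves both families; in a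
  product of the two the signs can then cancel.\<close>

lemma prod_list_anticommute_perm:
  fixes f g :: "'i \<Rightarrow> 'r::ring_1"
  assumes f: "\<And>x y. f x * f y = - (f y * f x)" and g: "\<And>x y. g x * g y = - (g y * g x)"
    and "mset xs = mset ys"
  shows "\<exists>n::nat. prod_list (map f xs) = (-1) ^ n * prod_list (map f ys) \<and>
    prod_list (map g xs) = (-1) ^ n * prod_list (map g ys)"
  using assms(3)
proof (induction xs arbitrary: ys)
  case Nil
  then show ?case
    by (intro exI[of _ 0]) simp
next
  case (Cons x xs)
  then have "x \<in> set ys"
    by (metis list.set_intros(1) mset_eq_setD)
  then obtain us vs where ys: "ys = us @ x # vs"
    by (meson split_list)
  then obtain n where n: "prod_list (map f xs) = (-1) ^ n * prod_list (map f (us @ vs))"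
      "prod_list (map g xs) = (-1) ^ n * prod_list (map g (us @ vs))"
    using Cons.IH[of "us @ vs"] Cons.prems by auto
  have step: "h x * ((-1) ^ n * prod_list (map h (us @ vs))) = (-1) ^ (n + length us) * prod_list (map h ys)"
    if h: "\<And>x y. h x * h y = - (h y * h x)" for h :: "'i \<Rightarrow> 'r"
  proof -
    have "h x * ((-1) ^ n * prod_list (map h (us @ vs))) =
        (-1) ^ n * ((h x * prod_list (map h us)) * prod_list (map h vs))"
      by (simp add: mult_minus_one_power mult.assoc)
    also have "\<dots> = (-1) ^ (n + length us) * prod_list (map h ys)"
      unfolding prod_list_anticommute[of h x us, OF h] by (simp add: ys power_add mult.assoc)
    finally show ?thesis .
  qed
  show ?case
    using step[of f, OF f] step[of g, OF g] n by (intro exI[of _ "n + length us"]) simp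
qed

text \<open>Reversal inverts every pair of positions, which accounts for the binomial
  exponent.\<close>

lemma prod_list_anticommute_rev:
  fixes f :: "'i \<Rightarrow> 'r::ring_1"
  assumes f: "\<And>x y. f x * f y = - (f y * f x)"
  shows "prod_list (map f (rev xs)) = (-1) ^ (length xs choose 2) * prod_list (map f xs)"
proof (induction xs)
  case (Cons x xs)
  have "prod_list (map f (rev (x # xs))) = (-1) ^ (length xs choose 2) * (prod_list (map f xs) * f x)"
    by (simp add: Cons.IH mult.assoc)
  also have "prod_list (map f xs) * f x = (-1) ^ length xs * (f x * prod_list (map f xs))"
    using prod_list_anticommute[of f x xs, OF f] by (simp flip: mult.assoc power_add)
  finally show ?case
    by (simp add: numeral_2_eq_2 flip: mult.assoc power_add) (simp add: add.commute)
qed (simp add: binomial_eq_0)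

lemma lowering_anticommute:
  "e_gl (Proper i) (Pos \<gamma>) * e_gl (Proper j) (Pos \<gamma>) = - (e_gl (Proper j) (Pos \<gamma>) * e_gl (Proper i) (Pos \<gamma>))"
  by (simp add: e_commute[of "Proper i"])

lemma raising_anticommute:
  "e_gl (Pos \<gamma>) (Proper i) * e_gl (Pos \<gamma>) (Proper j) = - (e_gl (Pos \<gamma>) (Proper j) * e_gl (Pos \<gamma>) (Proper i))"
  by (simp add: e_commute[of "Pos \<gamma>" "Proper i"])

lemma polarization_anticommute:
  "e_gl (Pos \<gamma>) (Neg b) * e_gl (Pos \<gamma>) (Neg c) = - (e_gl (Pos \<gamma>) (Neg c) * e_gl (Pos \<gamma>) (Neg b))"
  by (simp add: e_commute[of "Pos \<gamma>" "Neg b"])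

text \<open>Reversing the raising letters nests the product: putting \<open>i\<close> in front of
  the list encloses the old product between \<open>e_gl (Proper i) (Pos \<gamma>)\<close> and
  \<open>e_gl (Pos \<gamma>) (Proper i)\<close>.\<close>

definition capelli_product :: "'a \<Rightarrow> 'l list \<Rightarrow> ('a, 'b, 'l) Ugl" where
  "capelli_product \<gamma> is = lowering \<gamma> is * raising \<gamma> (rev is)"

lemma capelli_product_rev: "capelli_product \<gamma> (rev is) = lowering \<gamma> (rev is) * raising \<gamma> is"
  by (simp add: capelli_product_def)

text \<open>Lowering and raising letters contribute the same sign of the rearrangement, and the
  reversal sign depends on the length only.\<close>

lemma capelli_product_perm:
  assumes "mset is = mset js"
  shows "capelli_product \<gamma> is = (capelli_product \<gamma> js :: ('a, 'b, 'l) Ugl)"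
proof -
  obtain n :: nat where
    "lowering \<gamma> is = (-1) ^ n * (lowering \<gamma> js :: ('a, 'b, 'l) Ugl)"
    "raising \<gamma> is = (-1) ^ n * (raising \<gamma> js :: ('a, 'b, 'l) Ugl)"
    using prod_list_anticommute_perm[of "\<lambda>j. e_gl (Proper j) (Pos \<gamma>) :: ('a, 'b, 'l) Ugl"
        "\<lambda>j. e_gl (Pos \<gamma>) (Proper j)", OF lowering_anticommute raising_anticommute assms] by blast
  moreover have "length is = length js"
    using assms by (rule mset_eq_length)
  moreover have "raising \<gamma> (rev is) = (-1) ^ (length is choose 2) * (raising \<gamma> is :: ('a, 'b, 'l) Ugl)" for "is"
    using prod_list_anticommute_rev[of "\<lambda>i. e_gl (Pos \<gamma>) (Proper i)", OF raising_anticommute] .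
  ultimately show ?thesis
    unfolding capelli_product_def by (cases "even n"; cases "even (length js choose 2)") simp_all
qed

text \<open>Two equal letters can be brought side by side at the cost of a sign, and the square of
  an element anticommuting with itself is zero over the complex numbers.\<close>

lemma raising_not_distinct:
  assumes "\<not> distinct is"
  shows "raising \<gamma> is = (0 :: ('a, 'b, 'l) Ugl)"
proof -
  let ?g = "\<lambda>i. e_gl (Pos \<gamma>) (Proper i) :: ('a, 'b, 'l) Ugl"
  obtain xs ys zs y where "is": "is = xs @ [y] @ ys @ [y] @ zs"
    using not_distinct_decomp[OF assms] by blast
  have "?g y * ?g y = - (?g y * ?g y)"
    by (rule raising_anticommute)
  then have "scaleU 2 (?g y * ?g y) = 0"
    using scaleU_add_left[of 1 1 "?g y * ?g y"] by (simp add: eq_neg_iff_add_eq_0)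
  then have "?g y * ?g y = 0"
    by simp
  moreover have "mset is = mset (y # y # xs @ ys @ zs)"
    by (simp add: "is")
  then obtain n :: nat where "raising \<gamma> is = (-1) ^ n * (raising \<gamma> (y # y # xs @ ys @ zs) :: ('a, 'b, 'l) Ugl)"
    using prod_list_anticommute_perm[of ?g ?g, OF raising_anticommute raising_anticommute] by blast
  ultimately show ?thesis
    by (simp flip: mult.assoc)
qed

lemma capelli_product_not_distinct:
  "\<not> distinct is \<Longrightarrow> capelli_product \<gamma> is = (0 :: ('a, 'b, 'l) Ugl)"
  using raising_not_distinct[of "rev is" \<gamma>, where 'b = 'b] by (simp add: capelli_product_def)

section \<open>Invariance under the general linear algebra\<close>

definition capelli_sum :: "'a \<Rightarrow> nat \<Rightarrow> ('a, 'b, 'l::finite) Ugl" where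
  "capelli_sum \<gamma> k = (\<Sum>is | length is = k. capelli_product \<gamma> is)"

lemma capelli_sum_Suc:
  "capelli_sum \<gamma> (Suc k) = (\<Sum>i\<in>UNIV. e_gl (Proper i) (Pos \<gamma>) * capelli_sum \<gamma> k * e_gl (Pos \<gamma>) (Proper i))"
  by (simp add: capelli_sum_def sum_lists_length_Suc capelli_product_def sum_distrib_left sum_distrib_right mult.assoc)

lemma sum_of_bool_scaleU:
  fixes f :: "'i::finite \<Rightarrow> ('a, 'b, 'l) Ugl"
  shows "(\<Sum>i\<in>UNIV. scaleU (of_bool (i = a)) (f i)) = f a"
    and "(\<Sum>i\<in>UNIV. scaleU (of_bool (a = i)) (f i)) = f a"
proof -
  have "scaleU (of_bool (i = a)) (f i) = (if i = a then f i else 0)" for i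
    by simp
  then show "(\<Sum>i\<in>UNIV. scaleU (of_bool (i = a)) (f i)) = f a"
    by simp
  then show "(\<Sum>i\<in>UNIV. scaleU (of_bool (a = i)) (f i)) = f a"
    by (simp add: eq_commute)
qed

text \<open>Moving the proper generator in from the left and in from the right yields the same extra
  term, with outer letters indexed by \<open>a\<close> and \<open>b\<close>; in the middle it
  commutes by induction.\<close>

lemma capelli_sum_commute:
  "e_gl (Proper a) (Proper b) * (capelli_sum \<gamma> k :: ('a, 'b, 'l::finite) Ugl) = capelli_sum \<gamma> k * e_gl (Proper a) (Proper b)"
proof (induction k)
  case 0
  then show ?case
    by (simp add: capelli_sum_def capelli_product_def)
next
  case (Suc k)
  let ?T = "capelli_sum \<gamma> k :: ('a, 'b, 'l) Ugl"
  let ?f = "\<lambda>i. e_gl (Proper i) (Pos \<gamma>) :: ('a, 'b, 'l) Ugl" and ?g = "\<lambda>i. e_gl (Pos \<gamma>) (Proper i) :: ('a, 'b, 'l) Ugl"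
    and ?e = "e_gl (Proper a) (Proper b) :: ('a, 'b, 'l) Ugl"
  have f: "?e * ?f i = ?f i * ?e + scaleU (of_bool (i = b)) (?f a)" for i
    by (simp add: e_commute[of "Proper a"])
  have g: "?g i * ?e = ?e * ?g i + scaleU (of_bool (i = a)) (?g b)" for i
    by (simp add: e_commute[of "Pos \<gamma>"])
  have "?e * (?f i * ?T * ?g i) = ?f i * ?e * ?T * ?g i + scaleU (of_bool (i = b)) (?f a * ?T * ?g i)" for i
    by (simp add: f distrib_right flip: mult.assoc)
  then have l: "?e * capelli_sum \<gamma> (Suc k) = (\<Sum>i\<in>UNIV. ?f i * ?e * ?T * ?g i) + ?f a * ?T * ?g b"
    by (simp only: capelli_sum_Suc sum_distrib_left sum.distrib sum_of_bool_scaleU)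
  have "?f i * ?T * ?g i * ?e = ?f i * (?T * ?e) * ?g i + scaleU (of_bool (i = a)) (?f i * ?T * ?g b)" for i
    by (simp add: g distrib_left mult.assoc)
  then have "capelli_sum \<gamma> (Suc k) * ?e = (\<Sum>i\<in>UNIV. ?f i * (?T * ?e) * ?g i) + ?f a * ?T * ?g b"
    by (simp only: capelli_sum_Suc sum_distrib_right sum.distrib sum_of_bool_scaleU)
  then show ?case
    by (simp add: l Suc.IH[symmetric] mult.assoc)
qed

lemma finite_lists_length: "finite {is :: 'l::finite list. length is = k}"
  using finite_lists_length_eq[of "UNIV :: 'l set" k] by simp

text \<open>Lists with a repetition contribute zero, and all orderings of a set of \<open>k\<close>
  indices contribute equally.\<close>

lemma capelli_sum_sorted:
  "capelli_sum \<gamma> k = (scaleU (fact k)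
    (\<Sum>is \<in> {is. length is = k \<and> sorted_wrt (<) is}. capelli_product \<gamma> (rev is)) :: ('a, 'b, 'l::{finite, linorder}) Ugl)"
proof -
  let ?S = "{is :: 'l list. length is = k \<and> distinct is}"
  let ?T = "{is :: 'l list. length is = k \<and> sorted_wrt (<) is}"
  have fin: "finite ?S" "finite ?T"
    by (rule finite_subset[OF _ finite_lists_length[of k]]; auto)+
  have "capelli_sum \<gamma> k = (\<Sum>is\<in>?S. capelli_product \<gamma> is :: ('a, 'b, 'l) Ugl)"
    unfolding capelli_sum_def
    by (rule sum.mono_neutral_right) (auto simp: finite_lists_length capelli_product_not_distinct)
  also have "\<dots> = (\<Sum>js\<in>?T. \<Sum>is\<in>{is \<in> ?S. sort is = js}. capelli_product \<gamma> is)"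
    by (rule sum.group[symmetric]) (use fin in \<open>auto simp: strict_sorted_iff\<close>)
  also have "\<dots> = (\<Sum>js\<in>?T. scaleU (fact k) (capelli_product \<gamma> (rev js)))"
  proof (rule sum.cong[OF refl])
    fix js
    assume "js \<in> ?T"
    then have js: "length js = k" "sorted js" "distinct js"
      by (auto simp: strict_sorted_iff)
    \<comment> \<open>The fibre of sorting over \<open>js\<close> consists of all orderings of its
      set, which gives the factor \<open>fact k\<close>.\<close>
    have "{is \<in> ?S. sort is = js} = permutations_of_set (set js)"
    proof (intro set_eqI iffI)
      fix "is"
      assume "is \<in> {is \<in> ?S. sort is = js}"
      then show "is \<in> permutations_of_set (set js)"
        by (auto simp: permutations_of_set_def)
    next
      fix "is"
      assume "is \<in> permutations_of_set (set js)"
      then have "set is = set js" "distinct is"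
        by (auto simp: permutations_of_set_def)
      then show "is \<in> {is \<in> ?S. sort is = js}"
        using js sorted_distinct_set_unique[of "sort is" js] distinct_card[of "is"] distinct_card[of js]
        by simp
    qed
    then have "card {is \<in> ?S. sort is = js} = fact k"
      using js by (simp add: distinct_card)
    moreover have "capelli_product \<gamma> is = (capelli_product \<gamma> (rev js) :: ('a, 'b, 'l) Ugl)"
      if "is \<in> {is \<in> ?S. sort is = js}" for "is"
      using that by (intro capelli_product_perm) auto
    ultimately show "(\<Sum>is\<in>{is \<in> ?S. sort is = js}. capelli_product \<gamma> is) =
        (scaleU (fact k) (capelli_product \<gamma> (rev js)) :: ('a, 'b, 'l) Ugl)"
      using scaleU_of_nat[of "fact k" "capelli_product \<gamma> (rev js) :: ('a, 'b, 'l) Ugl"] by simp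
  qed
  finally show ?thesis
    by (simp add: Ugl.scale_sum_right)
qed

section \<open>Capelli and Schur elements\<close>

lemma commute_Ugl_proper:
  assumes "\<And>i j. z * e_gl (Proper i) (Proper j) = e_gl (Proper i) (Proper j) * z" and "x \<in> Ugl_proper"
  shows "z * x = x * z"
  using assms(2)
proof induction
  case (mult x y)
  then show ?case
    by (metis mult.assoc)
qed (simp_all add: assms(1) algebra_simps)

text \<open>The virtual sum \<open>X\<close> commutes exactly with the proper generators and is
  congruent to \<open>H\<close> modulo \<open>Irr\<close>. Hence each commutator of \<open>H\<close>
  with a generator is both proper and in \<open>Irr\<close>, so it is zero.\<close>

lemma capelli_element_center:
  "(capelli_element \<gamma> k :: ('a, 'b, 'l::{finite, linorder}) Ugl) \<in> center_Ugl_proper"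
proof -
  let ?T = "{is :: 'l list. length is = k \<and> sorted_wrt (<) is}"
  define X where "X = (\<Sum>is\<in>?T. capelli_product \<gamma> (rev is) :: ('a, 'b, 'l) Ugl)"
  define H where "H = (capelli_element \<gamma> k :: ('a, 'b, 'l) Ugl)"
  have "\<exists>u\<in>Ugl_proper. (capelli_product \<gamma> (rev is) :: ('a, 'b, 'l) Ugl) - u \<in> Irr" for "is" :: "'l list"
    using lowering_raising_Virt[of "rev is" "is"] by (auto simp: capelli_product_rev)
  then obtain u where u: "\<And>is. u is \<in> Ugl_proper"
      "\<And>is. (capelli_product \<gamma> (rev is) :: ('a, 'b, 'l) Ugl) - u is \<in> Irr"
    by metis
  have H: "H = (\<Sum>is\<in>?T. u is)"
    using devirt_eqI[OF u] by (simp add: H_def capelli_element_def capelli_product_rev)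
  have H_proper: "H \<in> Ugl_proper"
    unfolding H by (rule Ugl_proper_sum) (rule u(1))
  have XH: "X - H \<in> Irr"
    unfolding X_def H sum_subtractf[symmetric] by (rule Irr_sum) (rule u(2))
  have "H * e_gl (Proper i) (Proper j) = e_gl (Proper i) (Proper j) * H" for i j
  proof -
    let ?e = "e_gl (Proper i) (Proper j) :: ('a, 'b, 'l) Ugl"
    have "X = scaleU (1 / fact k) (capelli_sum \<gamma> k)"
      by (simp add: X_def capelli_sum_sorted)
    then have "X * ?e = ?e * X"
      by (simp add: capelli_sum_commute)
    then have "H * ?e - ?e * H = ?e * (X - H) - (X - H) * ?e"
      by (simp add: algebra_simps)
    also have "\<dots> \<in> Irr"
      by (intro Irr_diff Irr_mult_left Irr_mult_right XH)
    finally have "H * ?e - ?e * H = 0"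
      by (intro Ugl_proper_Irr_trivial Ugl_proper_diff Ugl_proper.mult H_proper Ugl_proper.generator)
    then show ?thesis
      by simp
  qed
  then show ?thesis
    using H_proper commute_Ugl_proper unfolding center_Ugl_proper_def H_def by blast
qed

section \<open>The one-row shape\<close>

lemma conjugate_column:
  assumes "1 \<le> k"
  shows "conjugate (replicate k 1) = [k]"
  using assms by (cases k) (simp_all add: conjugate_def first_part_def)

lemma hook_product_row: "hook_product [k] = fact k"
proof -
  have cells: "cells [k] = Pair 0 ` {..<k}"
    by (auto simp: cells_def)
  have "card (hook [k] (0, j)) = k - j" if "j < k" for j
  proof -
    have "hook [k] (0, j) = Pair 0 ` {j..<k}"
      using that by (auto simp: hook_def cells)
    then show ?thesis
      by (simp add: card_image inj_on_def)
  qed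
  then have "hook_product [k] = (\<Prod>j<k. k - j)"
    by (simp add: hook_product_def cells prod.reindex inj_on_def)
  then show ?thesis
    by (simp add: fact_prod_rev atLeast0LessThan)
qed

lemma row_strict_tableaux_row:
  "row_strict_tableaux [k] = (\<lambda>row. [row]) ` {row. length row = k \<and> sorted_wrt (<) row}"
  by (auto simp: row_strict_tableaux_def tableaux_def)

lemma e_tab_row:
  "length S = length T \<Longrightarrow> e_tab [S] [T] = prod_list (map (\<lambda>(a, b). e_gl a b) (zip S T))"
  by (simp add: e_tab_def e_word_def)

text \<open>For a single row only the symbol \<open>\<alpha> 1\<close> occurs. The two inner factors
  form a polarization round trip, which contributes the factorial; what is left is a Capelli
  summand.\<close>

lemma double_young_capelli_row:
  fixes \<alpha> :: "nat \<Rightarrow> 'a" and \<beta> :: "nat \<Rightarrow> 'b" and "is" :: "'l::finite list"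
  assumes "inj_on \<beta> {1..length is}" and "u \<in> Ugl_proper"
    and "\<And>\<gamma>. (lowering \<gamma> (rev is) * raising \<gamma> is :: ('a, 'b, 'l) Ugl) - u \<in> Irr"
  shows "double_young_capelli \<alpha> \<beta> [length is] [is] [is] = scaleU (fact (length is)) u"
proof -
  let ?\<gamma> = "\<alpha> 1" and ?bs = "map \<beta> [1..<Suc (length is)]"
  let ?up = "\<lambda>bs. prod_list (map (\<lambda>b. e_gl (Pos ?\<gamma>) (Neg b)) bs) :: ('a, 'b, 'l) Ugl"
  let ?down = "prod_list (map (\<lambda>b. e_gl (Neg b) (Pos ?\<gamma>)) ?bs) :: ('a, 'b, 'l) Ugl"
  let ?l = "lowering ?\<gamma> :: 'l list \<Rightarrow> ('a, 'b, 'l) Ugl"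
  let ?s = "(-1) ^ (length is choose 2) :: ('a, 'b, 'l) Ugl"
  have rev_up: "?up (rev ?bs) = ?s * ?up ?bs"
    using prod_list_anticommute_rev[of "\<lambda>b. e_gl (Pos ?\<gamma>) (Neg b) :: ('a, 'b, 'l) Ugl" ?bs, OF polarization_anticommute]
    by (simp del: upt_Suc)
  have rev_l: "?l (rev is) = ?s * ?l is"
    using prod_list_anticommute_rev[of "\<lambda>i. e_gl (Proper i) (Pos ?\<gamma>) :: ('a, 'b, 'l) Ugl" "is", OF lowering_anticommute] .
  \<comment> \<open>The lists have equal length, so the two reversals carry the same sign and it
    squares to 1.\<close>
  have swap: "?l is * ?up ?bs = ?l (rev is) * ?up (rev ?bs)"
    unfolding rev_up rev_l by (cases "even (length is choose 2)") simp_all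
  have "{1..<Suc (length is)} = {1..length is}"
    by auto
  then have "distinct ?bs"
    using assms(1) by (simp add: distinct_map del: upt_Suc)
  then have trip: "?up (rev ?bs) * ?down * raising ?\<gamma> is - scaleU (fact (length is)) (raising ?\<gamma> is) \<in> Irr"
    using polarization_round_trip[of ?bs "is" ?\<gamma>] by (simp del: upt_Suc)
  have C: "C_star \<alpha> [length is] = [replicate (length is) (Pos ?\<gamma>)]"
    by (simp add: C_star_def)
  have "e_tab (map (map Proper) [is]) (C_star \<alpha> [length is]) = ?l is"
    "e_tab (C_star \<alpha> [length is]) (D_star \<beta> [length is]) = ?up ?bs"
    "e_tab (D_star \<beta> [length is]) (C_star \<alpha> [length is]) = ?down"
    "e_tab (C_star \<alpha> [length is]) (map (map Proper) [is]) = (raising ?\<gamma> is :: ('a, 'b, 'l) Ugl)"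
    by (simp_all add: e_tab_row C D_star_def zip_replicate1 zip_replicate2 o_def del: upt_Suc replicate_Suc)
  then have "double_young_capelli \<alpha> \<beta> [length is] [is] [is] = devirt (?l is * ?up ?bs * ?down * raising ?\<gamma> is)"
    by (simp only: double_young_capelli_def)
  also have "\<dots> = scaleU (fact (length is)) u"
  proof (rule devirt_eqI)
    have "?l (rev is) * (?up (rev ?bs) * ?down * raising ?\<gamma> is - scaleU (fact (length is)) (raising ?\<gamma> is)) +
        scaleU (fact (length is)) (?l (rev is) * raising ?\<gamma> is - u) \<in> Irr"
      by (intro Irr_add Irr_mult_left Irr_scaleU trip assms(3))
    then show "?l is * ?up ?bs * ?down * raising ?\<gamma> is - scaleU (fact (length is)) u \<in> Irr"
      unfolding swap by (simp add: right_diff_distrib Ugl.scale_right_diff_distrib mult.assoc)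
  qed (rule Ugl_proper_scaleU[OF assms(2)])
  finally show ?thesis .
qed

theorem proposition4p11:
  fixes \<alpha>\<^sub>0 :: "'a::finite"
    and \<alpha> :: "nat \<Rightarrow> 'a" and \<beta> :: "nat \<Rightarrow> 'b::finite"
    and k :: nat
  assumes "1 \<le> k" and "k \<le> card (UNIV :: 'l::{finite, linorder} set)"
    and "admissible \<alpha> \<beta> (conjugate (replicate k 1))"
  shows "(capelli_element \<alpha>\<^sub>0 k :: ('a, 'b, 'l) Ugl) = schur_element \<alpha> \<beta> (replicate k 1) \<and>
         (schur_element \<alpha> \<beta> (replicate k 1) :: ('a, 'b, 'l) Ugl) \<in> center_Ugl_proper"
proof -
  let ?T = "{is :: 'l list. length is = k \<and> sorted_wrt (<) is}"
  have \<beta>: "inj_on \<beta> {1..k}"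
    using assms(3) unfolding conjugate_column[OF assms(1)] by (simp add: admissible_def first_part_def)
  \<comment> \<open>One \<open>u\<close> for all \<open>\<gamma>\<close> serves the Capelli summand
    at \<open>\<alpha>\<^sub>0\<close> and the bitableau at \<open>\<alpha> 1\<close> alike.\<close>
  have "\<exists>u\<in>Ugl_proper. \<forall>\<gamma>. (lowering \<gamma> (rev is) * raising \<gamma> is :: ('a, 'b, 'l) Ugl) - u \<in> Irr" for "is" :: "'l list"
    using lowering_raising_Virt[of "rev is" "is"] by simp
  then obtain u where u: "\<And>is. u is \<in> Ugl_proper"
      "\<And>is \<gamma>. (lowering \<gamma> (rev is) * raising \<gamma> is :: ('a, 'b, 'l) Ugl) - u is \<in> Irr"
    by metis
  \<comment> \<open>The hook product of the row, \<open>fact k\<close>, will cancel the factor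
    contributed by each bitableau.\<close>
  have "schur_element \<alpha> \<beta> (replicate k 1) = scaleU (1 / fact k) (\<Sum>is\<in>?T. scaleU (fact k) (u is))"
    unfolding schur_element_def conjugate_column[OF assms(1)] hook_product_row row_strict_tableaux_row
    using double_young_capelli_row[OF _ u] \<beta>
    by (subst sum.reindex) (auto simp: inj_on_def intro!: arg_cong[where f = "scaleU _"] sum.cong)
  also have "\<dots> = (\<Sum>is\<in>?T. u is)"
    by (simp add: Ugl.scale_sum_right)
  also have "\<dots> = capelli_element \<alpha>\<^sub>0 k"
    unfolding capelli_element_def using devirt_eqI[OF u] by (intro sum.cong) auto
  finally show ?thesis
    using capelli_element_center by metis
qed

end
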